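(* For every positive integer $t$ and every $r\ge 2$ there exist $\varepsilon=\varepsilon_{t,r}>0$ and $n_0=n_{t,r}$ such that the following holds. Suppose $G$ is a $K_r^+[t]$-free graph with $m$ edges, and $H$ is a complete $r$-partite graph with $V(H)\subseteq V(G)$, each partite set of $H$ having at least $n_0$ vertices, such that $G$ and $H$ (viewing $H$ as a graph on $V(G)$ by adding isolated vertices) differ in at most $\varepsilon m$ edges; moreover, when $r\ge 3$, all partite sets of $H$ have equal size. Then $$\lambda^2(G)\le\left(1-\frac1r\right)2m,$$ with equality if and only if $G$ is a complete bipartite graph when $r=2$, or $G$ is the regular complete $r$-partite graph (all parts equal in size) when $r\ge 3$.
   Context: All graphs are finite and simple; isolated vertices are ignored. $K_r[t]$ is the complete $r$-partite graph with all parts of size $t$, and $K_r^+[t]$ is obtained from $K_r[t]$ by adding one edge inside one of its parts. $F$-free means no subgraph isomorphic to $F$. "Differ in at most $\varepsilon m$ edges" means the edit distance (minimum number of edge additions/deletions to transform one graph into the other) is at most $\varepsilon m$. $\lambda(G)$ is the spectral radius of the adjacency matrix. *)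

theory Defs
  imports "HOL-Analysis.Analysis" "Jordan_Normal_Form.Spectral_Radius"
begin

text \<open>A finite simple graph on vertex set {0..<n} is given by its edge set,
  a set of 2-element subsets of {0..<n}. Isolated vertices are irrelevant.\<close>
definition simple_graph :: "nat \<Rightarrow> nat set set \<Rightarrow> bool" where
  "simple_graph n E \<longleftrightarrow> (\<forall>e\<in>E. card e = 2 \<and> e \<subseteq> {0..<n})"

definition adj_mat :: "nat \<Rightarrow> nat set set \<Rightarrow> complex mat" where
  "adj_mat n E = mat n n (\<lambda>(i, j). if {i, j} \<in> E then 1 else 0)"

definition graph_lambda :: "nat \<Rightarrow> nat set set \<Rightarrow> real" where
  "graph_lambda n E = spectral_radius (adj_mat n E)"

definition cmp_edges :: "nat \<Rightarrow> (nat \<Rightarrow> 'b set) \<Rightarrow> 'b set set" where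
  "cmp_edges k P = {{u, v} | u v i j. i < k \<and> j < k \<and> i \<noteq> j \<and> u \<in> P i \<and> v \<in> P j}"

definition Krplus_edges :: "nat \<Rightarrow> nat \<Rightarrow> (nat \<times> nat) set set" where
  "Krplus_edges r t = cmp_edges r (\<lambda>i. {i} \<times> {0..<t}) \<union> {{(0, 0), (0, 1)}}"

definition contains_subgraph :: "'b set set \<Rightarrow> 'a set set \<Rightarrow> bool" where
  "contains_subgraph EF E \<longleftrightarrow> (\<exists>f. inj_on f (\<Union>EF) \<and> (\<forall>e\<in>EF. f ` e \<in> E))"

definition free :: "'b set set \<Rightarrow> 'a set set \<Rightarrow> bool" where
  "free EF E \<longleftrightarrow> \<not> contains_subgraph EF E"

text \<open>E is (up to isolated vertices) a complete k-partite graph.\<close>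
definition is_complete_multipartite :: "nat \<Rightarrow> 'a set set \<Rightarrow> bool" where
  "is_complete_multipartite k E \<longleftrightarrow>
     (\<exists>Q :: nat \<Rightarrow> 'a set. (\<forall>i<k. Q i \<noteq> {}) \<and>
        (\<forall>i<k. \<forall>j<k. i \<noteq> j \<longrightarrow> Q i \<inter> Q j = {}) \<and> E = cmp_edges k Q)"

text \<open>E is (up to isolated vertices) the regular complete k-partite graph:
  all k parts have the same size.\<close>
definition is_regular_complete_multipartite :: "nat \<Rightarrow> 'a set set \<Rightarrow> bool" where
  "is_regular_complete_multipartite k E \<longleftrightarrow>
     (\<exists>Q :: nat \<Rightarrow> 'a set. (\<forall>i<k. Q i \<noteq> {}) \<and>
        (\<forall>i<k. \<forall>j<k. i \<noteq> j \<longrightarrow> Q i \<inter> Q j = {}) \<and>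
        (\<forall>i<k. \<forall>j<k. card (Q i) = card (Q j)) \<and> E = cmp_edges k Q)"

end

theory Submission
  imports Defs
begin

text \<open>
  Let x be the nonnegative unit vector of absolute values of an eigenvector for an eigenvalue of
  modulus \<open>\<lambda>\<close>, and let y be the vector of squares of its entries. By Cauchy--Schwarz \<open>\<lambda>\<^sup>2\<close> is at most
  2m times the sum of \<open>y u * y v\<close> over ordered pairs of adjacent vertices, so it suffices to bound
  that sum by 1 - 1/r. One may assume that \<open>\<lambda>\<^sup>2\<close> is at least (1 - 1/r)2m; then x is close to the
  Perron vector of H, so y is nearly uniform on each part of H, with mass about 1/r per part.

  Call a vertex weak if its neighbourhood has density at most r - 1 - 1/8 in the parts of H.
  Since G contains no \<open>K\<^sub>r\<^sup>+[t]\<close> and is close to H, every vertex has few neighbours in some part, and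
  adjacent vertices that are not weak are assigned different parts in this way. Hence G is
  r-partite apart from the weak vertices, which carry little mass and each see mass smaller than
  1 - 1/r by a constant; a Motzkin--Straus argument absorbs them. In the case of equality the weak
  vertices have mass zero and \<open>x u * x v\<close> is constant on the edges, which forces the structure of G.
\<close>

section \<open>Ordered pairs of adjacent vertices and the spectral radius\<close>

text \<open>Each edge is counted in both directions, so the sum of \<open>x u * x v\<close> over
  \<open>opairs E\<close> is the quadratic form of the adjacency matrix, without a factor 2.\<close>

definition opairs :: "'a set set \<Rightarrow> ('a \<times> 'a) set" where
  "opairs F = {(u, v). {u, v} \<in> F}"

lemma opairs_iff [simp]: "(u, v) \<in> opairs F \<longleftrightarrow> {u, v} \<in> F"
  by (simp add: opairs_def)

lemma simple_graph_edgeD: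
  assumes "simple_graph n E" "{u, v} \<in> E"
  shows "u < n" "v < n" "u \<noteq> v"
  using assms by (force simp: simple_graph_def)+

lemma simple_graph_mono: "simple_graph n E \<Longrightarrow> F \<subseteq> E \<Longrightarrow> simple_graph n F"
  by (auto simp: simple_graph_def)

lemma simple_graph_finite: "simple_graph n E \<Longrightarrow> finite E"
  by (rule finite_subset[of _ "Pow {0..<n}"]) (auto simp: simple_graph_def)

lemma opairs_subset: "simple_graph n E \<Longrightarrow> opairs E \<subseteq> {..<n} \<times> {..<n}"
  by (auto dest: simple_graph_edgeD)

lemma finite_opairs: "simple_graph n E \<Longrightarrow> finite (opairs E)"
  by (rule finite_subset[OF opairs_subset]) auto

lemma card_opairs:
  assumes "simple_graph n E"
  shows "card (opairs E) = 2 * card E"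
proof -
  have "card {(u, v). {u, v} = e} = 2" if "e \<in> E" for e
  proof -
    have "card e = 2" using assms that by (auto simp: simple_graph_def)
    then obtain a b where "e = {a, b}" "a \<noteq> b" by (auto simp: card_2_iff)
    moreover from this have "{(u, v). {u, v} = e} = {(a, b), (b, a)}"
      by (auto simp: doubleton_eq_iff)
    ultimately show ?thesis by simp
  qed
  moreover have "opairs E = (\<Union>e\<in>E. {(u, v). {u, v} = e})" by auto
  moreover have "card (\<Union>e\<in>E. {(u, v). {u, v} = e}) = (\<Sum>e\<in>E. card {(u, v). {u, v} = e})"
  proof (rule card_UN_disjoint)
    show "finite E" using assms by (rule simple_graph_finite)
    show "\<forall>e\<in>E. finite {(u, v). {u, v} = e}"
      using calculation(1) by (metis card.infinite zero_neq_numeral)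
  qed auto
  ultimately show ?thesis by simp
qed

lemma sum_opairs_split:
  assumes "simple_graph n E"
  shows "(\<Sum>(u, v)\<in>opairs E. g u v) = (\<Sum>u<n. \<Sum>v | {u, v} \<in> E. g u v)"
proof -
  have "opairs E = Sigma {..<n} (\<lambda>u. {v. {u, v} \<in> E})"
    using assms by (auto dest: simple_graph_edgeD)
  moreover have "finite {v. {u, v} \<in> E}" for u
    by (rule finite_subset[of _ "{..<n}"]) (use assms in \<open>auto dest: simple_graph_edgeD\<close>)
  ultimately show ?thesis by (simp add: sum.Sigma)
qed

text \<open>The ordered edges are the disjoint union of the rectangles
  \<open>P i \<times> P j\<close> over ordered pairs of distinct indices.\<close>

lemma sum_opairs_cmp_edges:
  assumes "\<And>i. i < r \<Longrightarrow> finite (P i)"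
    and "\<And>i j. i < r \<Longrightarrow> j < r \<Longrightarrow> i \<noteq> j \<Longrightarrow> P i \<inter> P j = {}"
  shows "(\<Sum>(u, v)\<in>opairs (cmp_edges r P). g u v)
    = (\<Sum>i<r. \<Sum>j\<in>{..<r} - {i}. \<Sum>u\<in>P i. \<Sum>v\<in>P j. g u v)"
proof -
  let ?I = "Sigma {..<r} (\<lambda>i. {..<r} - {i})"
  have "opairs (cmp_edges r P) = (\<Union>(i, j)\<in>?I. P i \<times> P j)"
    by (auto simp: cmp_edges_def doubleton_eq_iff) blast+
  then have "(\<Sum>(u, v)\<in>opairs (cmp_edges r P). g u v)
    = (\<Sum>p\<in>?I. \<Sum>(u, v)\<in>(case p of (i, j) \<Rightarrow> P i \<times> P j). g u v)"
    using assms by (simp only:, subst sum.UNION_disjoint) (auto, blast+)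
  also have "\<dots> = (\<Sum>(i, j)\<in>?I. \<Sum>u\<in>P i. \<Sum>v\<in>P j. g u v)"
    by (intro sum.cong) (auto simp: sum.cartesian_product)
  finally show ?thesis by (simp add: sum.Sigma)
qed

lemma cmp_edges_iff:
  assumes "\<And>i j. i < r \<Longrightarrow> j < r \<Longrightarrow> i \<noteq> j \<Longrightarrow> P i \<inter> P j = {}"
    and "i < r" "u \<in> P i"
  shows "{u, v} \<in> cmp_edges r P \<longleftrightarrow> (\<exists>j<r. j \<noteq> i \<and> v \<in> P j)"
proof
  assume "{u, v} \<in> cmp_edges r P"
  then obtain k l where "k < r" "l < r" "k \<noteq> l" "u \<in> P k" "v \<in> P l"
    by (auto simp: cmp_edges_def doubleton_eq_iff)
  moreover from this have "k = i" using assms by blast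
  ultimately show "\<exists>j<r. j \<noteq> i \<and> v \<in> P j" by blast
next
  assume "\<exists>j<r. j \<noteq> i \<and> v \<in> P j"
  then obtain j where "j < r" "i \<noteq> j" "v \<in> P j" by blast
  then show "{u, v} \<in> cmp_edges r P" using assms(2,3) unfolding cmp_edges_def by blast
qed

lemma simple_graph_cmp_edges:
  assumes sub: "\<And>i. i < r \<Longrightarrow> P i \<subseteq> {0..<n}"
    and disj: "\<And>i j. i < r \<Longrightarrow> j < r \<Longrightarrow> i \<noteq> j \<Longrightarrow> P i \<inter> P j = {}"
  shows "simple_graph n (cmp_edges r P)"
  unfolding simple_graph_def
proof
  fix e assume "e \<in> cmp_edges r P"
  then obtain u v i j where e: "e = {u, v}" "i < r" "j < r" "i \<noteq> j" "u \<in> P i" "v \<in> P j"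
    by (auto simp: cmp_edges_def)
  then have "u \<noteq> v" "u \<in> {0..<n}" "v \<in> {0..<n}" using disj[of i j] sub[of i] sub[of j] by blast+
  then show "card e = 2 \<and> e \<subseteq> {0..<n}" using e(1) by simp
qed

lemma card_cmp_edges:
  fixes P :: "nat \<Rightarrow> nat set"
  assumes "\<And>i. i < r \<Longrightarrow> P i \<subseteq> {0..<n}"
    and "\<And>i j. i < r \<Longrightarrow> j < r \<Longrightarrow> i \<noteq> j \<Longrightarrow> P i \<inter> P j = {}"
    and "\<And>i j. i < r \<Longrightarrow> j < r \<Longrightarrow> i \<noteq> j \<Longrightarrow> card (P i) * card (P j) = M"
  shows "2 * card (cmp_edges r P) = r * (r - 1) * M"
proof -
  have fin: "finite (P i)" if "i < r" for i
    by (rule finite_subset[OF assms(1)[OF that]]) simp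
  have "2 * card (cmp_edges r P) = card (opairs (cmp_edges r P))"
    using card_opairs[OF simple_graph_cmp_edges[OF assms(1,2)]] by simp
  also have "\<dots> = (\<Sum>(u, v)\<in>opairs (cmp_edges r P). 1)" by (simp add: case_prod_beta)
  also have "\<dots> = (\<Sum>i<r. \<Sum>j\<in>{..<r} - {i}. \<Sum>u\<in>P i. \<Sum>v\<in>P j. 1)"
    using fin assms(2) by (rule sum_opairs_cmp_edges)
  also have "\<dots> = (\<Sum>i<r. \<Sum>j\<in>{..<r} - {i}. M)"
    by (intro sum.cong) (auto simp: assms(3))
  finally show ?thesis by simp
qed

section \<open>Eigenvectors of the adjacency matrix\<close>

lemma adj_mat_mult_vec:
  assumes "simple_graph n E" "v \<in> carrier_vec n" "u < n"
  shows "(adj_mat n E *\<^sub>v v) $ u = (\<Sum>w | {u, w} \<in> E. v $ w)"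
proof -
  have "(adj_mat n E *\<^sub>v v) $ u = (\<Sum>w<n. if {u, w} \<in> E then v $ w else 0)"
    using assms by (auto simp: adj_mat_def scalar_prod_def lessThan_atLeast0 intro!: sum.cong)
  also have "\<dots> = (\<Sum>w\<in>{..<n} \<inter> {w. {u, w} \<in> E}. v $ w)"
    by (simp add: sum.inter_restrict)
  also have "{..<n} \<inter> {w. {u, w} \<in> E} = {w. {u, w} \<in> E}"
    using assms(1) by (auto dest: simple_graph_edgeD)
  finally show ?thesis .
qed

lemma adj_mat_carrier: "adj_mat n E \<in> carrier_mat n n"
  by (simp add: adj_mat_def)

lemma graph_lambda_nonneg: "n > 0 \<Longrightarrow> graph_lambda n E \<ge> 0"
  using spectral_radius_mem_max(1)[OF adj_mat_carrier, of n E] by (auto simp: graph_lambda_def)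

text \<open>The absolute values of an eigenvector for an eigenvalue of maximal modulus.\<close>
lemma graph_lambda_le_quadratic_form:
  assumes E: "simple_graph n E" and n: "n > 0"
  obtains x :: "nat \<Rightarrow> real" where "\<And>u. x u \<ge> 0" "(\<Sum>u<n. (x u)\<^sup>2) = 1"
    "graph_lambda n E \<le> (\<Sum>(u, v)\<in>opairs E. x u * x v)"
proof -
  obtain k where k: "eigenvalue (adj_mat n E) k" "norm k = graph_lambda n E"
    using spectral_radius_mem_max(1)[OF adj_mat_carrier n, of E]
    by (auto simp: graph_lambda_def spectrum_def)
  then obtain v where v: "v \<in> carrier_vec n" "v \<noteq> 0\<^sub>v n"
    "adj_mat n E *\<^sub>v v = k \<cdot>\<^sub>v v"
    unfolding eigenvalue_def eigenvector_def by (auto simp: adj_mat_def)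
  define s where "s = (\<Sum>u<n. (norm (v $ u))\<^sup>2)"
  obtain u where u: "u < n" "v $ u \<noteq> 0"
    using v(1,2) by (metis carrier_vecD eq_vecI index_zero_vec)
  have "s > 0"
    unfolding s_def using u by (intro sum_pos2[of _ u]) auto
  define x where "x u = norm (v $ u) / sqrt s" for u
  show ?thesis
  proof
    show "x u \<ge> 0" for u using \<open>s > 0\<close> by (simp add: x_def)
    show 1: "(\<Sum>u<n. (x u)\<^sup>2) = 1"
      using \<open>s > 0\<close> by (simp add: x_def power_divide sum_divide_distrib[symmetric] s_def)
    \<comment> \<open>The triangle inequality in row \<open>u\<close> of the eigenvalue equation:
      passing to absolute values leaves an inequality in the direction needed for an upper
      bound.\<close>
    have le: "graph_lambda n E * x u \<le> (\<Sum>w | {u, w} \<in> E. x w)" if "u < n" for u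
    proof -
      have "norm k * norm (v $ u) = norm (\<Sum>w | {u, w} \<in> E. v $ w)"
        using adj_mat_mult_vec[OF E v(1) that] v that by (simp flip: norm_mult)
      also have "\<dots> \<le> (\<Sum>w | {u, w} \<in> E. norm (v $ w))" by (rule norm_sum)
      finally show ?thesis
        using k(2) \<open>s > 0\<close>
        by (simp add: x_def sum_divide_distrib[symmetric] divide_right_mono)
    qed
    have "graph_lambda n E = (\<Sum>u<n. x u * (graph_lambda n E * x u))"
      using 1 by (simp add: sum_distrib_left[symmetric] power2_eq_square mult.left_commute[of _ "graph_lambda n E"])
    also have "\<dots> \<le> (\<Sum>u<n. x u * (\<Sum>w | {u, w} \<in> E. x w))"
      using le \<open>s > 0\<close> by (intro sum_mono mult_left_mono) (auto simp: x_def)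
    finally show "graph_lambda n E \<le> (\<Sum>(u, v)\<in>opairs E. x u * x v)"
      by (simp add: sum_opairs_split[OF E] sum_distrib_left)
  qed
qed

text \<open>Gives lower bounds from explicit real eigenvectors; the entries are embedded in the
  complex numbers because \<open>adj_mat\<close> is a complex matrix.\<close>

lemma graph_lambda_ge_eigenvalue:
  assumes E: "simple_graph n E" and z: "w < n" "z w \<noteq> 0"
    and ev: "\<And>u. u < n \<Longrightarrow> (\<Sum>v | {u, v} \<in> E. z v) = \<mu> * z u"
  shows "\<bar>\<mu>\<bar> \<le> graph_lambda n E"
proof -
  let ?v = "vec n (\<lambda>u. complex_of_real (z u))"
  have "adj_mat n E *\<^sub>v ?v = complex_of_real \<mu> \<cdot>\<^sub>v ?v"
  proof
    fix u assume "u < dim_vec (complex_of_real \<mu> \<cdot>\<^sub>v ?v)"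
    then have u: "u < n" by simp
    have "(adj_mat n E *\<^sub>v ?v) $ u = (\<Sum>v | {u, v} \<in> E. ?v $ v)"
      using E u by (intro adj_mat_mult_vec) auto
    also have "\<dots> = (\<Sum>v | {u, v} \<in> E. complex_of_real (z v))"
      using E by (intro sum.cong) (auto dest: simple_graph_edgeD)
    finally show "(adj_mat n E *\<^sub>v ?v) $ u = (complex_of_real \<mu> \<cdot>\<^sub>v ?v) $ u"
      using ev[OF u] u by (simp flip: of_real_sum of_real_mult)
  qed (simp add: adj_mat_def)
  moreover have "?v \<noteq> 0\<^sub>v n"
    using z by (metis index_vec index_zero_vec(1) of_real_eq_0_iff)
  ultimately have "complex_of_real \<mu> \<in> spectrum (adj_mat n E)"
    by (auto simp: spectrum_def eigenvalue_def eigenvector_def adj_mat_def intro!: exI[of _ ?v])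
  then have "norm (complex_of_real \<mu>) \<in> norm ` spectrum (adj_mat n E)" by (rule imageI)
  then show ?thesis
    using spectral_radius_mem_max(2)[OF adj_mat_carrier] z(1) by (force simp: graph_lambda_def)
qed

section \<open>The Motzkin--Straus inequality with weak vertices\<close>

text \<open>A robust Motzkin--Straus inequality. The vertices of L lose a term linear in the weight b of L,
  which beats the quadratic term gained by removing L from the r-partite part.\<close>
lemma motzkin_straus_weak:
  fixes y :: "nat \<Rightarrow> real" and r :: nat and c :: "nat \<Rightarrow> nat"
  assumes E: "simple_graph n E" and r: "r \<ge> 2" and y0: "\<And>u. y u \<ge> 0"
    and y1: "(\<Sum>u<n. y u) = 1" and L: "L \<subseteq> {..<n}"
    and c: "\<And>u. u < n \<Longrightarrow> u \<notin> L \<Longrightarrow> c u < r"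
    and proper: "\<And>u v. {u, v} \<in> E \<Longrightarrow> u \<notin> L \<Longrightarrow> v \<notin> L \<Longrightarrow> c u \<noteq> c v"
    and weak: "\<And>u. u \<in> L \<Longrightarrow> (\<Sum>v | {u, v} \<in> E. y v) \<le> 1 - 1 / r - d"
    and light: "(\<Sum>u\<in>L. y u) < 2 * d"
    and ge: "(\<Sum>(u, v)\<in>opairs E. y u * y v) \<ge> 1 - 1 / r"
  shows "(\<Sum>(u, v)\<in>opairs E. y u * y v) = 1 - 1 / r"
    and "\<And>u. u \<in> L \<Longrightarrow> y u = 0"
    and "\<And>i. i < r \<Longrightarrow> (\<Sum>u | u < n \<and> u \<notin> L \<and> c u = i. y u) = 1 / r"
    and "\<And>u v. u < n \<Longrightarrow> v < n \<Longrightarrow> u \<notin> L \<Longrightarrow> v \<notin> L \<Longrightarrow> c u \<noteq> c v \<Longrightarrow>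
      y u > 0 \<Longrightarrow> y v > 0 \<Longrightarrow> {u, v} \<in> E"
proof -
  \<comment> \<open>\<open>a i\<close> is the weight of colour class \<open>i\<close> outside
    \<open>L\<close>, and \<open>C\<close> is the complete multipartite graph on these classes,
    which contains every edge avoiding \<open>L\<close>.\<close>
  define X where "X = {..<n} - L"
  define b where "b = (\<Sum>u\<in>L. y u)"
  define a where "a i = (\<Sum>u | u < n \<and> u \<notin> L \<and> c u = i. y u)" for i
  define C where "C = {(u, v). u \<in> X \<and> v \<in> X \<and> c u \<noteq> c v}"
  define q :: real where "q = 1 - 1 / r"
  have finL: "finite L" using L by (rule finite_subset) simp
  have finX: "finite X" by (simp add: X_def)
  have finC: "finite C" by (rule finite_subset[of _ "X \<times> X"]) (auto simp: C_def finX)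
  note finO = finite_opairs[OF E]
  have b0: "b \<ge> 0" unfolding b_def using y0 by (rule sum_nonneg)
  have yX: "(\<Sum>u\<in>X. y u) = 1 - b"
    using sum.subset_diff[OF L, of y] y1 by (simp add: X_def b_def)
  have aX: "a i = (\<Sum>u | u \<in> X \<and> c u = i. y u)" for i
    unfolding a_def X_def by (rule sum.cong) auto
  have cX: "c ` X \<subseteq> {..<r}" using c by (auto simp: X_def)
  have sum_a: "(\<Sum>i<r. a i) = 1 - b"
    unfolding aX using sum.group[OF finX _ cX, of y] yX by simp
  \<comment> \<open>All pairs of \<open>X\<close> together contribute
    \<open>(1 - b)\<^sup>2\<close>; the pairs inside one class contribute the square of its
    weight.\<close>
  have CS: "(\<Sum>(u, v)\<in>C. y u * y v) = (1 - b)\<^sup>2 - (\<Sum>i<r. (a i)\<^sup>2)"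
  proof -
    have "(1 - b)\<^sup>2 = (\<Sum>u\<in>X. \<Sum>v\<in>X. y u * y v)"
      by (simp add: yX[symmetric] power2_eq_square sum_product)
    also have "\<dots> = (\<Sum>(u, v)\<in>X \<times> X. y u * y v)" by (simp add: sum.cartesian_product)
    also have "\<dots> = (\<Sum>(u, v)\<in>X \<times> X - C. y u * y v) + (\<Sum>(u, v)\<in>C. y u * y v)"
      using finX by (intro sum.subset_diff) (auto simp: C_def)
    also have "X \<times> X - C = Sigma X (\<lambda>u. {v \<in> X. c v = c u})" by (auto simp: C_def)
    also have "(\<Sum>(u, v)\<in>\<dots>. y u * y v) = (\<Sum>u\<in>X. y u * a (c u))"
      using finX by (simp add: sum.Sigma[symmetric] sum_distrib_left aX)
    also have "\<dots> = (\<Sum>i<r. \<Sum>u | u \<in> X \<and> c u = i. y u * a (c u))"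
      using sum.group[OF finX _ cX, of "\<lambda>u. y u * a (c u)"] by simp
    also have "\<dots> = (\<Sum>i<r. (a i)\<^sup>2)"
      by (rule sum.cong[OF refl]) (simp add: power2_eq_square sum_distrib_right[symmetric] aX)
    finally show ?thesis by simp
  qed
  \<comment> \<open>The class weights have mean \<open>(1 - b) / r\<close>, so their sum of squares
    is its minimum plus a variance.\<close>
  have var: "(\<Sum>i<r. (a i - (1 - b) / r)\<^sup>2) = (\<Sum>i<r. (a i)\<^sup>2) - (1 - b)\<^sup>2 / r"
  proof -
    have "(\<Sum>i<r. (a i - (1 - b) / r)\<^sup>2)
      = (\<Sum>i<r. (a i)\<^sup>2 - 2 * ((1 - b) / r) * a i + ((1 - b) / r)\<^sup>2)"
      by (rule sum.cong) (auto simp: power2_eq_square algebra_simps)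
    also have "\<dots> = (\<Sum>i<r. (a i)\<^sup>2) - 2 * ((1 - b) / r) * (1 - b) + r * ((1 - b) / r)\<^sup>2"
      by (simp add: sum.distrib sum_subtractf sum_distrib_left[symmetric] sum_divide_distrib[symmetric] sum_a)
    moreover have "2 * ((1 - b) / r) * (1 - b) - r * ((1 - b) / r)\<^sup>2 = (1 - b)\<^sup>2 / r"
      using r by (simp add: power2_eq_square field_simps)
    ultimately show ?thesis by simp
  qed
  define O1 where "O1 = {(u, v) \<in> opairs E. u \<notin> L \<and> v \<notin> L}"
  have O1C: "O1 \<subseteq> C" using E proper by (auto simp: O1_def C_def X_def dest: simple_graph_edgeD)
  define w where "w = (\<Sum>(u, v)\<in>O1. y u * y v)"
  have wC: "w \<le> (\<Sum>(u, v)\<in>C. y u * y v)"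
    unfolding w_def by (rule sum_mono2[OF finC O1C]) (auto simp: y0)
  have Lsum: "(\<Sum>(u, v)\<in>Sigma L (\<lambda>u. {v. {u, v} \<in> E}). y u * y v) \<le> b * (q - d)"
  proof -
    have "finite {v. {u, v} \<in> E}" for u
      by (rule finite_subset[of _ "{..<n}"]) (use E in \<open>auto dest: simple_graph_edgeD\<close>)
    then have "(\<Sum>(u, v)\<in>Sigma L (\<lambda>u. {v. {u, v} \<in> E}). y u * y v)
      = (\<Sum>u\<in>L. y u * (\<Sum>v | {u, v} \<in> E. y v))"
      using finL by (simp add: sum.Sigma[symmetric] sum_distrib_left)
    also have "\<dots> \<le> (\<Sum>u\<in>L. y u * (q - d))"
      using weak y0 by (intro sum_mono mult_left_mono) (auto simp: q_def)
    finally show ?thesis by (simp add: b_def sum_distrib_right)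
  qed
  let ?S = "Sigma L (\<lambda>u. {v. {u, v} \<in> E})"
  have finS: "finite ?S" by (rule finite_subset[OF _ finO]) auto
  \<comment> \<open>A pair that meets \<open>L\<close> starts in \<open>L\<close> or ends there,
    hence lies in \<open>?S\<close> or in its mirror image; both have the same sum.\<close>
  have "(\<Sum>(u, v)\<in>opairs E. y u * y v) \<le> (\<Sum>(u, v)\<in>O1 \<union> (?S \<union> prod.swap ` ?S). y u * y v)"
    using finS finite_subset[OF O1C finC]
    by (intro sum_mono2) (auto simp: O1_def y0 image_iff insert_commute)
  also have "\<dots> \<le> w + (\<Sum>(u, v)\<in>?S \<union> prod.swap ` ?S. y u * y v)"
    unfolding w_def using finS finite_subset[OF O1C finC] y0
    by (subst sum.union_inter[symmetric]) (auto intro!: sum_nonneg)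
  also have "(\<Sum>(u, v)\<in>?S \<union> prod.swap ` ?S. y u * y v)
    \<le> (\<Sum>(u, v)\<in>?S. y u * y v) + (\<Sum>(u, v)\<in>prod.swap ` ?S. y u * y v)"
    using finS y0
    by (subst sum.union_inter[symmetric]) (auto intro!: sum_nonneg)
  also have "(\<Sum>(u, v)\<in>prod.swap ` ?S. y u * y v) = (\<Sum>(u, v)\<in>?S. y u * y v)"
    by (subst sum.reindex) (auto intro!: sum.cong simp: inj_on_def mult.commute)
  finally have up: "(\<Sum>(u, v)\<in>opairs E. y u * y v) \<le> w + 2 * (b * (q - d))"
    using Lsum by linarith
  have var0: "(\<Sum>i<r. (a i - (1 - b) / r)\<^sup>2) \<ge> 0" by (simp add: sum_nonneg)
  have key: "(\<Sum>(u, v)\<in>C. y u * y v) = q * (1 - b)\<^sup>2 - (\<Sum>i<r. (a i - (1 - b) / r)\<^sup>2)"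
    unfolding CS var q_def by (simp add: algebra_simps)
  \<comment> \<open>The total is at most this value, and \<open>q * b \<le> b < 2 * d\<close> makes
    the bracket negative, so a total of at least \<open>q\<close> forces
    \<open>b = 0\<close>.\<close>
  have qq: "q * (1 - b)\<^sup>2 + 2 * (b * (q - d)) = q + b * (q * b - 2 * d)"
    by (simp add: power2_eq_square algebra_simps)
  have "q * b \<le> b" using b0 by (intro mult_left_le_one_le) (use r in \<open>auto simp: q_def field_simps\<close>)
  then have neg: "q * b - 2 * d < 0" using light by (simp add: b_def)
  have "b * (q * b - 2 * d) \<ge> 0"
    using ge up wC var0 key qq by (simp add: q_def)
  then have "b = 0" using neg b0 by (auto simp: zero_le_mult_iff)
  \<comment> \<open>With \<open>b = 0\<close>, total, \<open>w\<close>, sum over \<open>C\<close>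
    and \<open>q\<close> form an increasing chain that starts at least at \<open>q\<close>. It
    collapses, and each conclusion is one of its equality cases.\<close>
  then have tot: "(\<Sum>(u, v)\<in>opairs E. y u * y v) \<le> w" "(\<Sum>(u, v)\<in>C. y u * y v) = q - (\<Sum>i<r. (a i - 1 / r)\<^sup>2)"
    "(\<Sum>i<r. (a i - 1 / r)\<^sup>2) \<ge> 0"
    using up key var0 by auto
  show "(\<Sum>(u, v)\<in>opairs E. y u * y v) = 1 - 1 / r"
    using tot ge wC by (simp add: q_def)
  show "y u = 0" if "u \<in> L" for u
    using \<open>b = 0\<close> that finL y0 unfolding b_def by (simp add: sum_nonneg_eq_0_iff)
  have "(\<Sum>i<r. (a i - 1 / r)\<^sup>2) = 0" using tot ge wC by (simp add: q_def)
  then have "\<forall>i<r. (a i - 1 / r)\<^sup>2 = 0" by (simp add: sum_nonneg_eq_0_iff)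
  then show "(\<Sum>u | u < n \<and> u \<notin> L \<and> c u = i. y u) = 1 / r" if "i < r" for i
    using that by (simp add: a_def)
  have weq: "(\<Sum>(u, v)\<in>C. y u * y v) = w" using tot ge wC by (simp add: q_def)
  have "(\<Sum>(u, v)\<in>C - O1. y u * y v) = 0"
    using weq sum.subset_diff[OF O1C finC, of "\<lambda>(u, v). y u * y v"] by (simp add: w_def)
  then have z: "\<forall>p\<in>C - O1. (case p of (u, v) \<Rightarrow> y u * y v) = 0"
    using finC y0 by (subst (asm) sum_nonneg_eq_0_iff) auto
  show "{u, v} \<in> E" if "u < n" "v < n" "u \<notin> L" "v \<notin> L" "c u \<noteq> c v" "y u > 0" "y v > 0" for u v
  proof (rule ccontr)
    assume "{u, v} \<notin> E"
    then have "(u, v) \<in> C - O1" using that by (auto simp: C_def X_def O1_def)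
    with z have "(case (u, v) of (u, v) \<Rightarrow> y u * y v) = 0" by blast
    then show False using that by simp
  qed
qed

section \<open>Graphs close to a complete multipartite graph\<close>

text \<open>The product condition holds for two parts of any sizes and for r parts of equal sizes.\<close>
locale near_multipartite =
  fixes n r t s M :: nat and E :: "nat set set" and P :: "nat \<Rightarrow> nat set" and h :: real
  assumes r: "2 \<le> r" and s: "s = t + 2"
    and E: "simple_graph n E"
    and free: "free (Krplus_edges r t) E"
    and sub: "\<And>i. i < r \<Longrightarrow> P i \<subseteq> {0..<n}"
    and large: "\<And>i. i < r \<Longrightarrow> 32 * s \<le> card (P i)"
    and disj: "\<And>i j. i < r \<Longrightarrow> j < r \<Longrightarrow> i \<noteq> j \<Longrightarrow> P i \<inter> P j = {}"
    and prod: "\<And>i j. i < r \<Longrightarrow> j < r \<Longrightarrow> i \<noteq> j \<Longrightarrow> card (P i) * card (P j) = M"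
    and edit: "real (card ((E - cmp_edges r P) \<union> (cmp_edges r P - E))) \<le> h ^ 4 / 9 * real (card E)"
    and h: "h = 1 / (96 * (real r)\<^sup>2 * real s)"
begin

definition nbrs :: "nat \<Rightarrow> nat \<Rightarrow> nat set" where
  "nbrs u j = {w \<in> P j. {u, w} \<in> E}"

definition non_nbrs :: "nat \<Rightarrow> nat \<Rightarrow> nat set" where
  "non_nbrs u j = {w \<in> P j. {u, w} \<notin> E}"

text \<open>The threshold is chosen so that up to \<open>r * s\<close> vertices that are not bad
  together miss at most 1/64 of any other part.\<close>

definition bad :: "nat \<Rightarrow> nat set" where
  "bad i = {v \<in> P i. \<exists>j<r. j \<noteq> i \<and> card (non_nbrs v j) > card (P j) / (64 * r * s)}"

section \<open>Numerical bounds and edge counts\<close>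

lemma s_ge: "s \<ge> 1" "s > 0" "s \<ge> 2" "t < s"
  by (simp_all add: s)

lemma finP: "i < r \<Longrightarrow> finite (P i)"
  by (rule finite_subset[OF sub]) simp_all

lemma card_P_pos: "i < r \<Longrightarrow> card (P i) > 0"
  using large[of i] s_ge by simp

lemma finite_nbrs: "i < r \<Longrightarrow> finite (nbrs u i)" "i < r \<Longrightarrow> finite (non_nbrs u i)"
  using finP by (simp_all add: nbrs_def non_nbrs_def)

lemma card_nbrs:
  assumes "i < r"
  shows "card (nbrs u i) + card (non_nbrs u i) = card (P i)"
proof -
  have "P i = nbrs u i \<union> non_nbrs u i" by (auto simp: nbrs_def non_nbrs_def)
  then show ?thesis
    using card_Un_disjoint[OF finite_nbrs(1,2)[OF assms], of u u]
    by (simp add: nbrs_def non_nbrs_def disjoint_iff)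
qed

lemma simple_H: "simple_graph n (cmp_edges r P)"
  using sub disj by (rule simple_graph_cmp_edges)

lemma h_pos: "h > 0"
  using r s_ge by (simp add: h)

text \<open>In the form \<open>3 * h \<le> 1 / (32 * r)\<close> this bounds the error when masses
  are compared with densities.\<close>

lemma h_le: "96 * real r * h \<le> 1"
proof -
  have "96 * real r * h = 1 / (real r * real s)"
    using r s_ge by (simp add: h power2_eq_square)
  also have "\<dots> \<le> 1" using r s_ge(1) by (simp add: mult_ge1_I)
  finally show ?thesis .
qed

lemma h_le_1: "h \<le> 1"
proof -
  have "1 * h \<le> 96 * real r * h" using r h_pos by (intro mult_right_mono) auto
  then show ?thesis using h_le by linarith
qed

text \<open>The factor is the product of \<open>64 * r * s\<close> from the threshold in
  \<open>bad\<close>, \<open>64 * r\<^sup>2\<close> from the share of bad vertices allowed per pair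
  of parts, and \<open>r\<^sup>2\<close> from \<open>card_E_le\<close>.\<close>

lemma eps_le: "h ^ 4 / 9 * (4096 * real r ^ 5 * real s) \<le> 1"
proof -
  let ?R = "real r" and ?S = "real s"
  have ge1: "?R \<ge> 1" "?S \<ge> 1" using r s_ge by auto
  have hh: "h * (96 * ?R\<^sup>2 * ?S) = 1" using r s_ge by (simp add: h)
  have "?R ^ 5 * ?S ^ 1 \<le> ?R ^ 8 * ?S ^ 4"
    using ge1 by (intro mult_mono power_increasing) auto
  then have "4096 / 9 * (?R ^ 5 * ?S ^ 1) \<le> 96 ^ 4 * (?R ^ 8 * ?S ^ 4)"
    by (rule mult_mono[rotated]) auto
  then have "1 / 9 * (4096 * ?R ^ 5 * ?S) \<le> 96 ^ 4 * ?R ^ 8 * ?S ^ 4"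
    by (simp add: mult.assoc)
  then have "h ^ 4 * (1 / 9 * (4096 * ?R ^ 5 * ?S)) \<le> h ^ 4 * (96 ^ 4 * ?R ^ 8 * ?S ^ 4)"
    using h_pos by (intro mult_left_mono) auto
  also have "\<dots> = (h * (96 * ?R\<^sup>2 * ?S)) ^ 4"
    by (simp add: power_mult_distrib flip: power_mult)
  finally show ?thesis using hh by simp
qed

lemma eps_half: "h ^ 4 / 9 \<le> 1 / 2"
proof -
  have "real r ^ 5 * real s \<ge> 1" using r s_ge by (intro mult_ge1_I one_le_power) auto
  then have "h ^ 4 / 9 * (4096 * 1) \<le> h ^ 4 / 9 * (4096 * (real r ^ 5 * real s))"
    using h_pos by (intro mult_left_mono) auto
  then show ?thesis using eps_le by (simp add: mult.assoc)
qed

lemma card_H: "2 * real (card (cmp_edges r P)) = real r * (real r - 1) * M"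
proof -
  have "real (2 * card (cmp_edges r P)) = real (r * (r - 1) * M)"
    using card_cmp_edges[of r P n, OF sub disj prod] by simp
  then show ?thesis using r by (simp add: of_nat_diff)
qed

lemma card_diff_le:
  "real (card (E - cmp_edges r P)) \<le> h ^ 4 / 9 * real (card E)"
  "real (card (cmp_edges r P - E)) \<le> h ^ 4 / 9 * real (card E)"
proof -
  note fin = simple_graph_finite[OF E] simple_graph_finite[OF simple_H]
  have "card (E - cmp_edges r P) \<le> card ((E - cmp_edges r P) \<union> (cmp_edges r P - E))"
    "card (cmp_edges r P - E) \<le> card ((E - cmp_edges r P) \<union> (cmp_edges r P - E))"
    using fin by (auto intro!: card_mono)
  then show "real (card (E - cmp_edges r P)) \<le> h ^ 4 / 9 * real (card E)"
    "real (card (cmp_edges r P - E)) \<le> h ^ 4 / 9 * real (card E)"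
    using edit by linarith+
qed

lemma card_E_bounds:
  "(1 - h ^ 4 / 9) * real (card E) \<le> real (card (cmp_edges r P))"
  "real (card (cmp_edges r P)) \<le> (1 + h ^ 4 / 9) * real (card E)"
proof -
  note fin = simple_graph_finite[OF E] simple_graph_finite[OF simple_H]
  have "card E \<le> card (cmp_edges r P \<union> (E - cmp_edges r P))"
    "card (cmp_edges r P) \<le> card (E \<union> (cmp_edges r P - E))"
    using fin by (auto intro!: card_mono)
  moreover have "card (cmp_edges r P \<union> (E - cmp_edges r P)) \<le> card (cmp_edges r P) + card (E - cmp_edges r P)"
    "card (E \<union> (cmp_edges r P - E)) \<le> card E + card (cmp_edges r P - E)"
    by (rule card_Un_le)+
  ultimately show "(1 - h ^ 4 / 9) * real (card E) \<le> real (card (cmp_edges r P))"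
    "real (card (cmp_edges r P)) \<le> (1 + h ^ 4 / 9) * real (card E)"
    using card_diff_le by (simp_all add: algebra_simps)
qed

text \<open>An edit fraction of at most 1/2 gives at most twice the edges of the multipartite graph.
  Errors relative to \<open>card E\<close> thus become errors relative to the number
  \<open>M\<close> of pairs between two parts.\<close>

lemma card_E_le: "real (card E) \<le> (real r)\<^sup>2 * M"
proof -
  have "1 / 2 * real (card E) \<le> (1 - h ^ 4 / 9) * real (card E)"
    using eps_half by (intro mult_right_mono) auto
  then have "real (card E) \<le> 2 * real (card (cmp_edges r P))"
    using card_E_bounds by linarith
  also have "\<dots> \<le> (real r)\<^sup>2 * M"
    unfolding card_H power2_eq_square by (intro mult_right_mono mult_left_mono) auto
  finally show ?thesis .
qed

section \<open>Vertices that miss much of another part\<close>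

text \<open>Pairs missing between two parts are deleted edges, and distinct pairs give distinct
  edges because the parts are disjoint.\<close>

lemma missing_le:
  assumes "i < r" "j < r" "i \<noteq> j"
  shows "(\<Sum>v\<in>P i. real (card (non_nbrs v j))) \<le> h ^ 4 / 9 * (real r)\<^sup>2 * (card (P i) * card (P j))"
proof -
  let ?S = "Sigma (P i) (\<lambda>v. non_nbrs v j)"
  have "(\<Sum>v\<in>P i. card (non_nbrs v j)) = card ?S"
    using assms finP finite_nbrs by simp
  also have "\<dots> = card ((\<lambda>(u, v). {u, v}) ` ?S)"
  proof (rule card_image[symmetric])
    show "inj_on (\<lambda>(u, v). {u, v}) ?S"
      using disj[OF assms] by (auto simp: inj_on_def non_nbrs_def doubleton_eq_iff)
  qed
  also have "\<dots> \<le> card (cmp_edges r P - E)"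
  proof (rule card_mono)
    show "finite (cmp_edges r P - E)" using simple_graph_finite[OF simple_H] by simp
    show "(\<lambda>(u, v). {u, v}) ` ?S \<subseteq> cmp_edges r P - E"
      using assms by (auto simp: non_nbrs_def cmp_edges_def)
  qed
  finally have "real (\<Sum>v\<in>P i. card (non_nbrs v j)) \<le> h ^ 4 / 9 * real (card E)"
    using card_diff_le(2) by linarith
  also have "\<dots> \<le> h ^ 4 / 9 * ((real r)\<^sup>2 * M)"
    using h_pos by (intro mult_left_mono card_E_le) auto
  finally show ?thesis using prod[OF assms] by (simp add: mult.assoc flip: of_nat_mult)
qed

text \<open>Markov's inequality applied to \<open>missing_le\<close> for each other part
  \<open>j\<close>; the union over \<open>j\<close> costs one of the two factors \<open>r\<close> in
  the bound for \<open>?B j\<close>.\<close>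

lemma card_bad:
  assumes "i < r"
  shows "real (card (bad i)) \<le> card (P i) / (64 * r)"
proof -
  let ?B = "\<lambda>j. {v \<in> P i. card (non_nbrs v j) > card (P j) / (64 * r * s)}"
  have "card (?B j) \<le> card (P i) / (64 * (real r)\<^sup>2)" if j: "j < r" "j \<noteq> i" for j
  proof -
    define d where "d = 1 / (64 * real r * real s)"
    have Mpos: "real (card (P j)) > 0" using card_P_pos[OF j(1)] by simp
    have "real (card (?B j)) * (real (card (P j)) * d) = (\<Sum>v\<in>?B j. card (P j) * d)" by simp
    also have "\<dots> \<le> (\<Sum>v\<in>?B j. real (card (non_nbrs v j)))"
      by (intro sum_mono) (auto simp: d_def)
    also have "\<dots> \<le> (\<Sum>v\<in>P i. real (card (non_nbrs v j)))"
      using finP[OF assms] by (intro sum_mono2) auto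
    also have "\<dots> \<le> h ^ 4 / 9 * (real r)\<^sup>2 * (card (P i) * card (P j))"
      using assms j by (intro missing_le) auto
    finally have "(d * real (card (?B j))) * card (P j) \<le> (h ^ 4 / 9 * (real r)\<^sup>2 * card (P i)) * card (P j)"
      by (simp only: of_nat_mult mult.assoc mult.left_commute[of _ d] mult.commute[of _ d])
    then have "d * real (card (?B j)) \<le> h ^ 4 / 9 * (real r)\<^sup>2 * card (P i)"
      by (rule mult_right_le_imp_le[OF _ Mpos])
    then have "real (card (?B j)) * d \<le> h ^ 4 / 9 * (real r)\<^sup>2 * card (P i)"
      by (simp only: mult.commute)
    then have "real (card (?B j)) * d * (4096 * real r ^ 3 * real s)
      \<le> h ^ 4 / 9 * (real r)\<^sup>2 * card (P i) * (4096 * real r ^ 3 * real s)"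
      by (intro mult_right_mono) auto
    also have "\<dots> = h ^ 4 / 9 * (4096 * real r ^ 5 * real s) * card (P i)"
      by (simp add: power_numeral_reduce)
    also have "\<dots> \<le> 1 * real (card (P i))" using eps_le by (intro mult_right_mono) auto
    finally have *: "real (card (?B j)) * (d * (4096 * real r ^ 3 * real s)) \<le> card (P i)"
      by (simp only: mult.assoc mult_1)
    have "d * (4096 * real r ^ 3 * real s) = 64 * (real r)\<^sup>2"
      using r s_ge by (simp add: d_def divide_simps power_numeral_reduce)
    then have "card (?B j) * (64 * (real r)\<^sup>2) \<le> card (P i)" using * by (simp only:)
    then show ?thesis using r by (subst pos_le_divide_eq) auto
  qed
  then have "(\<Sum>j\<in>{..<r} - {i}. real (card (?B j))) \<le> (\<Sum>j\<in>{..<r} - {i}. card (P i) / (64 * (real r)\<^sup>2))"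
    by (intro sum_mono) auto
  also have "\<dots> \<le> r * (card (P i) / (64 * (real r)\<^sup>2))"
    using assms by (simp add: divide_right_mono mult_right_mono)
  also have "\<dots> = card (P i) / (64 * r)" using r by (simp add: power2_eq_square)
  finally have le: "(\<Sum>j\<in>{..<r} - {i}. real (card (?B j))) \<le> card (P i) / (64 * r)" .
  have "card (bad i) \<le> card (\<Union>j\<in>{..<r} - {i}. ?B j)"
    using finP[OF assms] by (intro card_mono) (auto simp: bad_def)
  also have "\<dots> \<le> (\<Sum>j\<in>{..<r} - {i}. card (?B j))" by (rule card_UN_le) simp
  finally have "real (card (bad i)) \<le> real (\<Sum>j\<in>{..<r} - {i}. card (?B j))"
    by (rule of_nat_mono)
  then show ?thesis using le by simp
qed

lemma good_non_nbrs:
  assumes "v \<in> P i" "v \<notin> bad i" "i < r" "j < r" "j \<noteq> i"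
  shows "real (card (non_nbrs v j)) \<le> card (P j) / (64 * r * s)"
  by (rule ccontr) (use assms in \<open>auto simp: bad_def\<close>)

section \<open>Embedding the forbidden graph\<close>

text \<open>The parts are treated one after another. The candidates in \<open>A k\<close> fill 1/16
  of \<open>P k\<close>; at most 1/64 of \<open>P k\<close> is lost to bad vertices and 1/64 to
  non-neighbours of earlier choices. The remaining 1/32 contains \<open>s\<close> vertices. Avoiding
  bad vertices keeps the choices usable later.\<close>

lemma greedy_multipartite:
  assumes A: "\<And>j. j < r \<Longrightarrow> A j \<subseteq> P j" "\<And>j. j < r \<Longrightarrow> card (P j) / 16 \<le> real (card (A j))"
    and "k \<le> r"
  shows "\<exists>T. (\<forall>j<k. T j \<subseteq> A j \<and> T j \<inter> bad j = {} \<and> card (T j) = s) \<and>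
    (\<forall>i<k. \<forall>j<k. i \<noteq> j \<longrightarrow> (\<forall>u\<in>T i. \<forall>v\<in>T j. {u, v} \<in> E))"
  using \<open>k \<le> r\<close>
proof (induction k)
  case 0
  show ?case by simp
next
  case (Suc k)
  then obtain T where T: "\<And>j. j < k \<Longrightarrow> T j \<subseteq> A j \<and> T j \<inter> bad j = {} \<and> card (T j) = s"
    "\<And>i j u v. i < k \<Longrightarrow> j < k \<Longrightarrow> i \<noteq> j \<Longrightarrow> u \<in> T i \<Longrightarrow> v \<in> T j \<Longrightarrow> {u, v} \<in> E"
    by (metis Suc_leD)
  have k: "k < r" using Suc.prems by simp
  define U where "U = (\<Union>j<k. T j)"
  have "card U \<le> (\<Sum>j<k. card (T j))" unfolding U_def by (rule card_UN_le) simp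
  also have "\<dots> = k * s" using T(1) by simp
  also have "\<dots> \<le> r * s" using k by (intro mult_le_mono) simp_all
  finally have cU: "card U \<le> r * s" .
  have finT: "finite (T j)" if "j < k" for j
    using T(1)[OF that] s_ge by (intro card_ge_0_finite) simp
  then have finU: "finite U" by (simp add: U_def)
  define F where "F = bad k \<union> (\<Union>u\<in>U. non_nbrs u k)"
  have "card (\<Union>u\<in>U. non_nbrs u k) \<le> (\<Sum>u\<in>U. card (non_nbrs u k))"
    using finU by (rule card_UN_le)
  then have "real (card (\<Union>u\<in>U. non_nbrs u k)) \<le> (\<Sum>u\<in>U. real (card (non_nbrs u k)))"
    by (metis of_nat_mono of_nat_sum)
  also have "\<dots> \<le> (\<Sum>u\<in>U. card (P k) / (64 * r * s))"
  proof (rule sum_mono)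
    fix u assume "u \<in> U"
    then obtain j where j: "j < k" "u \<in> T j" by (auto simp: U_def)
    have "j < r" using j(1) k by simp
    then have "u \<in> P j" "u \<notin> bad j" using T(1)[OF j(1)] j(2) A(1) by blast+
    then show "real (card (non_nbrs u k)) \<le> card (P k) / (64 * r * s)"
      using j(1) k by (intro good_non_nbrs[of u j]) auto
  qed
  also have "\<dots> = card U * (card (P k) / (64 * r * s))" by simp
  also have "\<dots> \<le> real (r * s) * (card (P k) / (64 * r * s))"
    using cU by (intro mult_right_mono of_nat_mono) auto
  also have "\<dots> = card (P k) / 64" using r s_ge by (simp add: divide_simps)
  finally have 1: "real (card (\<Union>u\<in>U. non_nbrs u k)) \<le> card (P k) / 64" .
  have "card (P k) / (64 * real r) \<le> card (P k) / 64"
    using r by (intro divide_left_mono) auto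
  then have "real (card (bad k)) \<le> card (P k) / 64" using card_bad[OF k] by linarith
  then have cF: "real (card F) \<le> card (P k) / 32"
    using 1 card_Un_le[of "bad k" "\<Union>u\<in>U. non_nbrs u k"] unfolding F_def by linarith
  have finF: "finite F"
    using finP[OF k] finU k by (auto simp: F_def bad_def finite_nbrs)
  have "card (A k) - card F \<le> card (A k - F)" using finF by (rule diff_card_le_card_Diff)
  moreover have "real s \<le> card (P k) / 32"
    using of_nat_mono[OF large[OF k], where ?'a = real] by simp
  ultimately have "s \<le> card (A k - F)" using A(2)[OF k] cF by linarith
  then obtain S where S: "S \<subseteq> A k - F" "card S = s"
    by (meson obtain_subset_with_card_n)
  have SU: "{u, v} \<in> E" if "u \<in> U" "v \<in> S" for u v
    using that S(1) A(1)[OF k] by (auto simp: F_def non_nbrs_def)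
  show ?case
  proof (intro exI[of _ "T(k := S)"] conjI allI impI ballI)
    fix j assume "j < Suc k"
    then show "(T(k := S)) j \<subseteq> A j" "(T(k := S)) j \<inter> bad j = {}" "card ((T(k := S)) j) = s"
      using T(1)[of j] S by (auto simp: F_def less_Suc_eq)
  next
    fix i j u v assume "i < Suc k" "j < Suc k" "i \<noteq> j" "u \<in> (T(k := S)) i" "v \<in> (T(k := S)) j"
    then show "{u, v} \<in> E"
      using T(2)[of i j u v] SU[of u v] SU[of v u]
      by (auto simp: U_def less_Suc_eq insert_commute split: if_splits)
  qed
qed

text \<open>With many common neighbours in all parts but \<open>P i\<close>, the edge
  \<open>{u, w}\<close> could play the added edge of the forbidden graph, in the role of two
  vertices of part \<open>i\<close>. The vertices \<open>u\<close> and \<open>w\<close> may lie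
  anywhere.\<close>

lemma inner_edge_few_common_nbrs:
  assumes uw: "{u, w} \<in> E" and i: "i < r"
    and common: "\<And>j. j < r \<Longrightarrow> j \<noteq> i \<Longrightarrow> card (P j) / 16 \<le> real (card (nbrs u j \<inter> nbrs w j))"
  shows False
proof -
  define A where "A j = (if j = i then P i - {u, w} else nbrs u j \<inter> nbrs w j)" for j
  have "A j \<subseteq> P j" if "j < r" for j by (auto simp: A_def nbrs_def)
  moreover have "card (P j) / 16 \<le> real (card (A j))" if "j < r" for j
  proof (cases "j = i")
    case True
    have "card (P i) - card {u, w} \<le> card (A j)"
      unfolding A_def using True by (simp add: diff_card_le_card_Diff)
    moreover have "card {u, w} \<le> 2" by (simp add: card_insert_if)
    moreover have "card (P i) \<ge> 32" using large[OF i] s_ge by simp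
    ultimately have "real (card (P i)) \<le> real (card (A j)) + 2" "real (card (P i)) \<ge> 32"
      by linarith+
    then show ?thesis using True by simp
  qed (use common that in \<open>simp add: A_def\<close>)
  ultimately obtain T where T: "\<And>j. j < r \<Longrightarrow> T j \<subseteq> A j" "\<And>j. j < r \<Longrightarrow> card (T j) = s"
    "\<And>i j u v. i < r \<Longrightarrow> j < r \<Longrightarrow> i \<noteq> j \<Longrightarrow> u \<in> T i \<Longrightarrow> v \<in> T j \<Longrightarrow> {u, v} \<in> E"
    using greedy_multipartite[of A r] by (metis order.refl)
  have "\<exists>g. bij_betw g {0..<s} (T j)" if "j < r" for j
    using ex_bij_betw_nat_finite[of "T j"] T(2)[OF that] card_ge_0_finite[of "T j"] s_ge by simp
  then obtain g where g: "\<And>j. j < r \<Longrightarrow> bij_betw (g j) {0..<s} (T j)" by metis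
  have gT: "g j k \<in> T j" if "j < r" "k < s" for j k
    using bij_betwE[OF g[OF that(1)]] that(2) by simp
  have TP: "T j \<subseteq> P j" if "j < r" for j
    using T(1)[OF that] by (auto simp: A_def nbrs_def split: if_splits)
  have no_loop: "{a, a} \<notin> E" for a using simple_graph_edgeD(3)[OF E, of a a] by blast
  have uwT: "u \<notin> T j" "w \<notin> T j" if "j < r" for j
    using T(1)[OF that] no_loop by (auto simp: A_def nbrs_def split: if_splits)
  have uwE: "{u, v} \<in> E" "{w, v} \<in> E" if "j < r" "j \<noteq> i" "v \<in> T j" for j v
    using T(1)[OF that(1)] that by (auto simp: A_def nbrs_def)
  \<comment> \<open>The forbidden graph has its added edge in part 0, so the indices 0 and
    \<open>i\<close> are exchanged.\<close>
  define \<pi> where "\<pi> = Transposition.transpose 0 i"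
  have \<pi>: "\<pi> j < r" if "j < r" for j using that i by (auto simp: \<pi>_def Transposition.transpose_def)
  have \<pi>_eq: "\<pi> j = \<pi> k \<longleftrightarrow> j = k" for j k
    by (auto simp: \<pi>_def Transposition.transpose_def)
  have \<pi>_i: "\<pi> j = i \<longleftrightarrow> j = 0" for j by (auto simp: \<pi>_def Transposition.transpose_def)
  define f where "f p = (if p = (0, 0) then u else if p = (0, 1) then w else g (\<pi> (fst p)) (snd p))" for p
  let ?D = "{0..<r} \<times> {0..<s}"
  \<comment> \<open>Since \<open>s \<ge> 2\<close>, the end \<open>(0, 1)\<close> of the added edge
    lies in \<open>?D\<close> even for \<open>t = 1\<close>.\<close>
  have D: "\<Union>(Krplus_edges r t) \<subseteq> ?D"
    using r s_ge by (auto simp: Krplus_edges_def cmp_edges_def)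
  have "u \<noteq> w" using simple_graph_edgeD(3)[OF E uw] .
  have "inj_on f ?D"
  proof (rule inj_onI)
    fix p q assume pq: "p \<in> ?D" "q \<in> ?D" "f p = f q"
    obtain a k b l where [simp]: "p = (a, k)" "q = (b, l)" by fastforce
    have ab: "\<pi> a < r" "\<pi> b < r" "k < s" "l < s" using pq \<pi> by auto
    have "g (\<pi> a) k = g (\<pi> b) l \<Longrightarrow> a = b \<and> k = l"
    proof -
      assume eq: "g (\<pi> a) k = g (\<pi> b) l"
      then have "\<pi> a = \<pi> b"
        using gT[OF ab(1,3)] gT[OF ab(2,4)] TP[OF ab(1)] TP[OF ab(2)] disj[OF ab(1,2)] by auto
      moreover from this have "k = l"
        using g[OF ab(1)] eq ab by (auto simp: bij_betw_def inj_on_def)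
      ultimately show "a = b \<and> k = l" by (simp add: \<pi>_eq)
    qed
    moreover have "g (\<pi> a) k \<notin> {u, w}" "g (\<pi> b) l \<notin> {u, w}"
      using gT[OF ab(1,3)] gT[OF ab(2,4)] uwT[OF ab(1)] uwT[OF ab(2)] by auto
    ultimately show "p = q" using pq(3) \<open>u \<noteq> w\<close> by (auto simp: f_def split: if_splits)
  qed
  then have "inj_on f (\<Union>(Krplus_edges r t))" using D by (rule inj_on_subset)
  moreover have "f ` e \<in> E" if e: "e \<in> Krplus_edges r t" for e
  proof -
    consider "e = {(0, 0), (0, 1)}"
      | a b k l where "e = {(a, k), (b, l)}" "a < r" "b < r" "a \<noteq> b" "k < t" "l < t"
      using e unfolding Krplus_edges_def cmp_edges_def by fastforce
    then show ?thesis
    proof cases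
      case 1
      then show ?thesis using uw by (simp add: f_def insert_commute)
    next
      case (2 a b k l)
      have ab: "\<pi> a < r" "\<pi> b < r" "\<pi> a \<noteq> \<pi> b" using 2 \<pi> by (auto simp: \<pi>_eq)
      have gg: "g (\<pi> a) k \<in> T (\<pi> a)" "g (\<pi> b) l \<in> T (\<pi> b)" using gT ab 2 s_ge(4) by auto
      have 0: "a \<noteq> 0 \<longrightarrow> {u, g (\<pi> a) k} \<in> E \<and> {w, g (\<pi> a) k} \<in> E"
        "b \<noteq> 0 \<longrightarrow> {u, g (\<pi> b) l} \<in> E \<and> {w, g (\<pi> b) l} \<in> E"
        using uwE[OF ab(1) _ gg(1)] uwE[OF ab(2) _ gg(2)] by (auto simp: \<pi>_i)
      have "{f (a, k), f (b, l)} \<in> E"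
        using T(3)[OF ab gg] 0 2(4) by (auto simp: f_def insert_commute)
      then show ?thesis using 2(1) by simp
    qed
  qed
  ultimately show False using free unfolding free_def contains_subgraph_def by blast
qed

text \<open>Otherwise \<open>u\<close> has a neighbour \<open>w\<close> in \<open>P 0\<close> that
  is not bad. It misses at most 1/16 of every other part, so 1/8 - 1/16 = 1/16 of that part is
  adjacent to both, which \<open>inner_edge_few_common_nbrs\<close> forbids.\<close>

lemma few_nbrs_in_some_part: "\<exists>i<r. real (card (nbrs u i)) < card (P i) / 8"
proof (rule ccontr)
  assume "\<not> ?thesis"
  then have many: "card (P i) / 8 \<le> real (card (nbrs u i))" if "i < r" for i
    using that not_less by blast
  have r0: "0 < r" using r by simp
  have bound: "card (P j) / (64 * real r * a) \<le> card (P j) / 16" if "a \<ge> 1" for j and a :: real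
  proof (rule divide_left_mono)
    have "1 * 1 \<le> real r * a" using r that by (intro mult_mono) auto
    then show "16 \<le> 64 * real r * a" unfolding mult.assoc by linarith
    show "0 < 64 * real r * a * 16" using r that by simp
  qed auto
  have "card (nbrs u 0) > card (bad 0)"
    using many[OF r0] card_bad[OF r0] bound[of 1 0] card_P_pos[OF r0] by simp
  moreover have "finite (bad 0)" using finP[OF r0] by (simp add: bad_def)
  ultimately obtain w where w: "w \<in> nbrs u 0" "w \<notin> bad 0"
    by (meson card_mono leD subsetI)
  show False
  proof (rule inner_edge_few_common_nbrs[of u w 0])
    show "{u, w} \<in> E" using w by (simp add: nbrs_def)
    show "card (P j) / 16 \<le> real (card (nbrs u j \<inter> nbrs w j))" if j: "j < r" "j \<noteq> 0" for j
    proof -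
      have "card (nbrs u j) - card (non_nbrs w j) \<le> card (nbrs u j - non_nbrs w j)"
        using finite_nbrs(2)[OF j(1)] by (rule diff_card_le_card_Diff)
      also have "nbrs u j - non_nbrs w j = nbrs u j \<inter> nbrs w j"
        by (auto simp: nbrs_def non_nbrs_def)
      finally have "real (card (nbrs u j)) - real (card (non_nbrs w j)) \<le> card (nbrs u j \<inter> nbrs w j)"
        by linarith
      moreover have "real (card (non_nbrs w j)) \<le> card (P j) / 16"
        using good_non_nbrs[OF _ w(2) r0 j] bound[of "real s" j] s_ge w(1)
        by (simp add: nbrs_def)
      ultimately show ?thesis using many[OF j(1)] by linarith
    qed
  qed (use r in auto)
qed

section \<open>Colour classes and weak vertices\<close>

text \<open>This index serves as the colour of \<open>u\<close>. By \<open>strong_nbrs\<close> it is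
  the only possible choice for a vertex of the graph that is not weak.\<close>

definition cls :: "nat \<Rightarrow> nat" where
  "cls u = (SOME i. i < r \<and> real (card (nbrs u i)) < card (P i) / 8)"

lemma cls: "cls u < r" "real (card (nbrs u (cls u))) < card (P (cls u)) / 8"
  using someI_ex[OF few_nbrs_in_some_part[of u]] by (simp_all add: cls_def)

text \<open>Divided by \<open>r\<close>, this is the mass of \<open>S\<close> under the squared unit
  Perron vector of the complete multipartite graph.\<close>

definition density :: "nat set \<Rightarrow> real" where
  "density S = (\<Sum>i<r. card (S \<inter> P i) / card (P i))"

definition weak :: "nat set" where
  "weak = {u. u < n \<and> density {v. {u, v} \<in> E} \<le> real r - 1 - 1 / 8}"

lemma density_nbrs: "density {v. {u, v} \<in> E} = (\<Sum>i<r. card (nbrs u i) / card (P i))"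
  unfolding density_def nbrs_def
  by (intro sum.cong refl arg_cong2[of _ _ _ _ "(/)"] arg_cong[of _ _ "\<lambda>S. real (card S)"]) auto

text \<open>The part \<open>cls u\<close> contributes less than 1/8 to the density and the parts
  other than \<open>j\<close> and \<open>cls u\<close> at most \<open>r - 2\<close>, so more than
  3/4 is left for \<open>j\<close>.\<close>

lemma strong_nbrs:
  assumes "u < n" "u \<notin> weak" "j < r" "j \<noteq> cls u"
  shows "real (card (nbrs u j)) \<ge> 3 / 4 * card (P j)"
proof -
  let ?f = "\<lambda>i. card (nbrs u i) / card (P i)"
  have "(\<Sum>i\<in>{..<r} - {cls u} - {j}. ?f i) \<le> (\<Sum>i\<in>{..<r} - {cls u} - {j}. 1)"
  proof (rule sum_mono)
    fix i assume "i \<in> {..<r} - {cls u} - {j}"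
    then show "?f i \<le> 1" using card_nbrs[of i u] card_P_pos[of i] by simp
  qed
  also have "\<dots> = real r - 2" using assms cls(1)[of u] r by (simp add: of_nat_diff)
  finally have "(\<Sum>i<r. ?f i) \<le> ?f (cls u) + ?f j + (real r - 2)"
    using assms cls(1)[of u]
    by (simp add: sum.remove[of "{..<r}" "cls u"] sum.remove[of "{..<r} - {cls u}" j])
  moreover have "?f (cls u) < 1 / 8"
    using cls[of u] card_P_pos[of "cls u"] by (simp add: divide_less_eq)
  moreover have "(\<Sum>i<r. ?f i) > real r - 1 - 1 / 8"
    using assms(1,2) by (simp add: weak_def density_nbrs)
  ultimately have "?f j \<ge> 3 / 4" by linarith
  then show ?thesis using card_P_pos[OF assms(3)] by (simp add: le_divide_eq)
qed

text \<open>Two such vertices with the same colour would both see 3/4 of every other part, hence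
  have half of it in common.\<close>

lemma strong_proper:
  assumes uv: "{u, v} \<in> E" and "u \<notin> weak" "v \<notin> weak"
  shows "cls u \<noteq> cls v"
proof
  assume eq: "cls u = cls v"
  note n = simple_graph_edgeD[OF E uv]
  show False
  proof (rule inner_edge_few_common_nbrs[OF uv cls(1)[of u]])
    fix j assume j: "j < r" "j \<noteq> cls u"
    have "card (nbrs u j) + card (nbrs v j) = card (nbrs u j \<union> nbrs v j) + card (nbrs u j \<inter> nbrs v j)"
      using finite_nbrs[OF j(1)] by (intro card_Un_Int) auto
    moreover have "card (nbrs u j \<union> nbrs v j) \<le> card (P j)"
      using finP[OF j(1)] by (intro card_mono) (auto simp: nbrs_def)
    moreover have "real (card (nbrs u j)) \<ge> 3 / 4 * card (P j)" "real (card (nbrs v j)) \<ge> 3 / 4 * card (P j)"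
      using strong_nbrs[of u j] strong_nbrs[of v j] assms n j eq by auto
    ultimately show "card (P j) / 16 \<le> real (card (nbrs u j \<inter> nbrs v j))" by linarith
  qed
qed

text \<open>A vertex of \<open>P i\<close> that is not bad misses at most a share
  \<open>1 / (64 * r)\<close> of each other part, so its density exceeds
  \<open>r - 1 - 1 / 64\<close>.\<close>

lemma weak_Int_subset_bad:
  assumes i: "i < r"
  shows "weak \<inter> P i \<subseteq> bad i"
proof (rule subsetI, rule ccontr)
  fix u assume u: "u \<in> weak \<inter> P i" "u \<notin> bad i"
  let ?f = "\<lambda>j. card (nbrs u j) / card (P j)"
  have "1 - 1 / (64 * real r) \<le> ?f j" if j: "j \<in> {..<r} - {i}" for j
  proof -
    have "real (card (non_nbrs u j)) \<le> card (P j) / (64 * r * s)"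
      using good_non_nbrs[of u i j] u i j by auto
    also have "\<dots> \<le> card (P j) / (64 * real r)"
      using r s_ge by (intro divide_left_mono) auto
    finally have "real (card (P j)) - card (P j) / (64 * real r) \<le> card (nbrs u j)"
      using card_nbrs[of j u] j by simp
    then have "(1 - 1 / (64 * real r)) * card (P j) \<le> card (nbrs u j)"
      by (simp add: algebra_simps)
    then show ?thesis using card_P_pos[of j] j by (simp add: le_divide_eq)
  qed
  then have "(\<Sum>j\<in>{..<r} - {i}. 1 - 1 / (64 * real r)) \<le> (\<Sum>j\<in>{..<r} - {i}. ?f j)"
    by (rule sum_mono)
  also have "\<dots> \<le> (\<Sum>j<r. ?f j)" by (intro sum_mono2) auto
  also have "\<dots> \<le> real r - 1 - 1 / 8" using u by (simp add: weak_def density_nbrs)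
  finally have "(real r - 1) * (1 - 1 / (64 * real r)) \<le> real r - 1 - 1 / 8"
    using i r by (simp add: of_nat_diff)
  moreover have "(real r - 1) * (1 - 1 / (64 * real r)) = real r - 1 - 1 / 64 + 1 / (64 * real r)"
    using r by (simp add: field_simps)
  moreover have "1 / (64 * real r) > 0" using r by simp
  ultimately show False by linarith
qed

text \<open>Vertices outside the parts have no density, so only bad vertices of the parts
  count.\<close>

lemma density_weak: "density weak \<le> 1 / 64"
proof -
  have "card (weak \<inter> P i) / card (P i) \<le> 1 / (64 * real r)" if i: "i < r" for i
  proof -
    have "card (weak \<inter> P i) \<le> card (bad i)"
      using weak_Int_subset_bad[OF i] finP[OF i] by (intro card_mono) (auto simp: bad_def)
    then have "real (card (weak \<inter> P i)) \<le> card (P i) / (64 * real r)"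
      using card_bad[OF i] by linarith
    then show ?thesis using card_P_pos[OF i] by (simp add: divide_le_eq)
  qed
  then have "density weak \<le> (\<Sum>i<r. 1 / (64 * real r))"
    unfolding density_def by (intro sum_mono) auto
  then show ?thesis using r by simp
qed

section \<open>Comparison with the Perron vector\<close>

lemma card_E_pos: "real (card E) > 0"
proof -
  have "M > 0" using prod[of 0 1] card_P_pos[of 0] card_P_pos[of 1] r by (auto intro: gr0I)
  then have "real r * (real r - 1) * M > 0" using r by simp
  then have "0 < (1 + h ^ 4 / 9) * real (card E)" using card_H card_E_bounds(2) by linarith
  moreover have "0 < 1 + h ^ 4 / 9" using h_pos by (simp add: add_pos_pos)
  ultimately show ?thesis by (simp add: zero_less_mult_iff)
qed

text \<open>If x almost attains the largest possible value of the quadratic form of H, then it is close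
  in norm to the Perron vector of H, whose entries are 1 / sqrt (r * card (P i)) on P i.\<close>
lemma mass_le_density:
  fixes x :: "nat \<Rightarrow> real"
  assumes x0: "\<And>u. x u \<ge> 0" and x1: "(\<Sum>u<n. (x u)\<^sup>2) = 1"
    and big: "(1 - 1 / real r) * (2 * real (card E)) \<le> (\<Sum>(u, v)\<in>opairs E. x u * x v)\<^sup>2"
    and S: "S \<subseteq> {..<n}"
  shows "(\<Sum>u\<in>S. (x u)\<^sup>2) \<le> density S / r + 3 * h"
proof -
  \<comment> \<open>\<open>z\<close> is the Perron vector extended by zero, and \<open>p\<close> is
    its inner product with \<open>x\<close>. The aim is to show that \<open>p\<^sup>2\<close> is
    close to 1.\<close>
  define z where "z u = (\<Sum>i<r. if u \<in> P i then 1 / sqrt (real r * card (P i)) else 0)" for u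
  define p where "p = (\<Sum>u<n. x u * z u)"
  have rpos: "real r > 0" using r by simp
  have z2: "(z u)\<^sup>2 = (\<Sum>i<r. if u \<in> P i then 1 / (real r * card (P i)) else 0)" for u
  proof (cases "\<exists>i<r. u \<in> P i")
    case True
    then obtain i where i: "i < r" "u \<in> P i" by blast
    have only: "u \<in> P j \<longleftrightarrow> j = i" if "j < r" for j using disj[OF that i(1)] i(2) by auto
    have "z u = (\<Sum>j<r. if j = i then 1 / sqrt (real r * card (P i)) else 0)"
      unfolding z_def by (intro sum.cong) (auto simp: only)
    moreover have "(\<Sum>i<r. if u \<in> P i then 1 / (real r * card (P i)) else 0)
      = (\<Sum>j<r. if j = i then 1 / (real r * card (P i)) else 0)"
      by (intro sum.cong) (auto simp: only)
    ultimately show ?thesis using i by (simp add: power_divide)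
  next
    case False
    then show ?thesis by (simp add: z_def)
  qed
  have sum_z2: "(\<Sum>u\<in>A. (z u)\<^sup>2) = density A / r" if "A \<subseteq> {..<n}" for A
  proof -
    have fin: "finite A" using that by (rule finite_subset) simp
    have "(\<Sum>u\<in>A. (z u)\<^sup>2) = (\<Sum>i<r. \<Sum>u\<in>A. if u \<in> P i then 1 / (real r * card (P i)) else 0)"
      unfolding z2 by (rule sum.swap)
    also have "\<dots> = (\<Sum>i<r. card (A \<inter> P i) / card (P i) / r)"
      using fin by (intro sum.cong) (auto simp: sum.If_cases Int_def field_simps)
    finally show ?thesis by (simp add: density_def sum_divide_distrib)
  qed
  have density_full: "density {..<n} = r"
  proof -
    have "{..<n} \<inter> P i = P i" if "i < r" for i using sub[OF that] by auto
    then have "density {..<n} = (\<Sum>i<r. 1)"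
      unfolding density_def using card_P_pos by (intro sum.cong) auto
    then show ?thesis by simp
  qed
  have z1: "(\<Sum>u<n. (z u)\<^sup>2) = 1" using sum_z2[of "{..<n}"] density_full rpos by simp
  have dist: "(\<Sum>u<n. (x u - p * z u)\<^sup>2) = 1 - p\<^sup>2"
  proof -
    have "(\<Sum>u<n. (x u - p * z u)\<^sup>2) = (\<Sum>u<n. (x u)\<^sup>2 - 2 * p * (x u * z u) + p\<^sup>2 * (z u)\<^sup>2)"
      by (intro sum.cong) (auto simp: power2_eq_square algebra_simps)
    also have "\<dots> = (\<Sum>u<n. (x u)\<^sup>2) - 2 * p * (\<Sum>u<n. x u * z u) + p\<^sup>2 * (\<Sum>u<n. (z u)\<^sup>2)"
      by (simp add: sum.distrib sum_subtractf sum_distrib_left)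
    also have "\<dots> = 1 - 2 * p * p + p\<^sup>2 * 1"
      by (simp only: x1 z1 p_def[symmetric])
    finally show ?thesis by (simp add: power2_eq_square)
  qed
  have p_le: "p\<^sup>2 \<le> 1"
    using sum_nonneg[of "{..<n}" "\<lambda>u. (x u - p * z u)\<^sup>2"] dist by simp

  define W where "W F = (\<Sum>(u, v)\<in>opairs F. x u * x v)" for F
  define \<tau> where "\<tau> i = (\<Sum>u\<in>P i. x u) / sqrt (card (P i))" for i
  have p_tau: "p = (\<Sum>i<r. \<tau> i) / sqrt r"
  proof -
    have "p = (\<Sum>i<r. \<Sum>u<n. if u \<in> P i then x u / sqrt (real r * card (P i)) else 0)"
      unfolding p_def z_def sum_distrib_left
      by (subst sum.swap) (intro sum.cong, auto)
    also have "\<dots> = (\<Sum>i<r. \<tau> i / sqrt r)"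
    proof (intro sum.cong refl)
      fix i assume "i \<in> {..<r}"
      then have "{..<n} \<inter> P i = P i" using sub[of i] by auto
      then show "(\<Sum>u<n. if u \<in> P i then x u / sqrt (real r * card (P i)) else 0) = \<tau> i / sqrt r"
        by (simp add: sum.If_cases \<tau>_def sum_divide_distrib[symmetric] real_sqrt_mult mult.commute)
    qed
    finally show ?thesis by (simp add: sum_divide_distrib)
  qed
  \<comment> \<open>Because \<open>card (P i) * card (P j) = M\<close>, the form between two parts
    is \<open>sqrt M * (\<tau> i * \<tau> j)\<close>. Cauchy-Schwarz for the \<open>\<tau> i\<close>
    then gives the top eigenvalue \<open>sqrt M * (r - 1)\<close> times
    \<open>p\<^sup>2\<close>.\<close>
  have WH: "W (cmp_edges r P) \<le> sqrt M * (real r - 1) * p\<^sup>2"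
  proof -
    have "W (cmp_edges r P) = (\<Sum>i<r. \<Sum>j\<in>{..<r} - {i}. \<Sum>u\<in>P i. \<Sum>v\<in>P j. x u * x v)"
      unfolding W_def using finP disj by (rule sum_opairs_cmp_edges)
    also have "\<dots> = (\<Sum>i<r. \<Sum>j\<in>{..<r} - {i}. sqrt M * (\<tau> i * \<tau> j))"
    proof (intro sum.cong refl)
      fix i j assume ij: "i \<in> {..<r}" "j \<in> {..<r} - {i}"
      then have "sqrt M = sqrt (card (P i)) * sqrt (card (P j))"
        using prod[of i j] by (auto simp flip: real_sqrt_mult of_nat_mult)
      moreover have "sqrt (card (P i)) > 0" "sqrt (card (P j)) > 0"
        using card_P_pos[of i] card_P_pos[of j] ij by auto
      ultimately show "(\<Sum>u\<in>P i. \<Sum>v\<in>P j. x u * x v) = sqrt M * (\<tau> i * \<tau> j)"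
        by (simp add: \<tau>_def sum_product)
    qed
    also have "\<dots> = (\<Sum>i<r. sqrt M * (\<tau> i * (\<Sum>j<r. \<tau> j) - (\<tau> i)\<^sup>2))"
      by (intro sum.cong refl)
        (simp add: sum_distrib_left sum_diff1 power2_eq_square right_diff_distrib)
    also have "\<dots> = sqrt M * ((\<Sum>i<r. \<tau> i)\<^sup>2 - (\<Sum>i<r. (\<tau> i)\<^sup>2))"
      by (simp add: sum_distrib_left[symmetric] sum_subtractf sum_distrib_right[symmetric] power2_eq_square)
    also have "\<dots> \<le> sqrt M * ((\<Sum>i<r. \<tau> i)\<^sup>2 - (\<Sum>i<r. \<tau> i)\<^sup>2 / r)"
      using sum_squared_le_sum_of_squares[of \<tau> "{..<r}"] rpos
      by (intro mult_left_mono diff_left_mono) (auto simp: divide_le_eq mult.commute)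
    also have "\<dots> = sqrt M * (real r - 1) * p\<^sup>2"
      using rpos by (simp add: p_tau power_divide field_simps)
    finally show ?thesis .
  qed

  \<comment> \<open>\<open>q * K\<close> is the assumed lower bound for \<open>W E\<close>. The
    allowed edit fraction is \<open>e\<^sup>2\<close>, and \<open>e\<close> is chosen so that the
    final error \<open>3 * e\<close> equals \<open>h\<^sup>2\<close>.\<close>
  define K where "K = sqrt (2 * real (card E))"
  define q where "q = sqrt (1 - 1 / real r)"
  define e where "e = h\<^sup>2 / 3"
  have e0: "e \<ge> 0" "e\<^sup>2 = h ^ 4 / 9" by (auto simp: e_def power_divide simp flip: power_mult)
  have K: "K > 0" "K\<^sup>2 = 2 * real (card E)" using card_E_pos by (auto simp: K_def)
  have q2: "q\<^sup>2 = 1 - 1 / real r" using r by (simp add: q_def)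
  have q0: "q \<ge> 1 / 2"
    unfolding q_def using r by (intro real_le_rsqrt) (simp add: power2_eq_square field_simps)
  have WE: "W E \<le> W (cmp_edges r P) + W (E - cmp_edges r P)"
  proof -
    note sD = simple_graph_mono[OF E, of "E - cmp_edges r P"]
    have "W E \<le> (\<Sum>(u, v)\<in>opairs (cmp_edges r P) \<union> opairs (E - cmp_edges r P). x u * x v)"
      unfolding W_def using finite_opairs[OF simple_H] finite_opairs[OF sD] x0
      by (intro sum_mono2) auto
    also have "\<dots> = W (cmp_edges r P) + W (E - cmp_edges r P)"
      unfolding W_def using finite_opairs[OF simple_H] finite_opairs[OF sD]
      by (intro sum.union_disjoint) auto
    finally show ?thesis .
  qed
  \<comment> \<open>Cauchy-Schwarz: the squares of \<open>x u * x v\<close> over all pairs sum to 1,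
    so the form is at most the square root of the number of ordered added edges.\<close>
  have WD: "W (E - cmp_edges r P) \<le> e * K"
  proof (rule power2_le_imp_le)
    note sD = simple_graph_mono[OF E, of "E - cmp_edges r P"]
    have "(W (E - cmp_edges r P))\<^sup>2
      \<le> (\<Sum>p\<in>opairs (E - cmp_edges r P). 1\<^sup>2) * (\<Sum>p\<in>opairs (E - cmp_edges r P). (case p of (u, v) \<Rightarrow> x u * x v)\<^sup>2)"
      using Cauchy_Schwarz_ineq_sum[of "\<lambda>_. 1" "\<lambda>(u, v). x u * x v" "opairs (E - cmp_edges r P)"]
      by (simp add: W_def)
    also have "(\<Sum>p\<in>opairs (E - cmp_edges r P). 1\<^sup>2) = 2 * real (card (E - cmp_edges r P))"
      using card_opairs[OF sD] by simp
    also have "(\<Sum>p\<in>opairs (E - cmp_edges r P). (case p of (u, v) \<Rightarrow> x u * x v)\<^sup>2)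
      \<le> (\<Sum>p\<in>{..<n} \<times> {..<n}. (case p of (u, v) \<Rightarrow> x u * x v)\<^sup>2)"
      using opairs_subset[OF sD] by (intro sum_mono2) auto
    also have "\<dots> = (\<Sum>u<n. (x u)\<^sup>2) * (\<Sum>v<n. (x v)\<^sup>2)"
      unfolding sum_product sum.cartesian_product
      by (intro sum.cong) (auto simp: power_mult_distrib)
    finally have "(W (E - cmp_edges r P))\<^sup>2 \<le> 2 * real (card (E - cmp_edges r P))"
      by (simp add: x1 mult_left_mono)
    also have "\<dots> \<le> (e * K)\<^sup>2"
      using card_diff_le(1) by (simp add: power_mult_distrib K e0 mult.commute)
    finally show "(W (E - cmp_edges r P))\<^sup>2 \<le> (e * K)\<^sup>2" .
    show "0 \<le> e * K" using e0 K by simp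
  qed
  have "q * K \<le> W E"
  proof (rule power2_le_imp_le)
    show "(q * K)\<^sup>2 \<le> (W E)\<^sup>2" using big by (simp add: power_mult_distrib q2 K W_def)
    show "0 \<le> W E" unfolding W_def by (intro sum_nonneg) (auto simp: x0)
  qed
  \<comment> \<open>The square of the left side is \<open>q\<^sup>2\<close> times twice the number
    of edges of the multipartite graph, which exceeds \<open>card E\<close> by at most the factor
    \<open>1 + e\<^sup>2\<close>.\<close>
  moreover have "sqrt M * (real r - 1) \<le> (1 + e\<^sup>2) * (q * K)"
  proof (rule power2_le_imp_le)
    have "(sqrt M * (real r - 1))\<^sup>2 = q\<^sup>2 * (2 * real (card (cmp_edges r P)))"
      unfolding card_H q2 using rpos by (simp add: power_mult_distrib power2_eq_square field_simps)
    also have "\<dots> \<le> q\<^sup>2 * ((1 + e\<^sup>2) * K\<^sup>2)"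
      using card_E_bounds(2) by (intro mult_left_mono) (auto simp: K e0)
    also have "\<dots> \<le> q\<^sup>2 * ((1 + e\<^sup>2)\<^sup>2 * K\<^sup>2)"
      using self_le_power[of "1 + e\<^sup>2" 2] by (intro mult_left_mono mult_right_mono) auto
    finally show "(sqrt M * (real r - 1))\<^sup>2 \<le> ((1 + e\<^sup>2) * (q * K))\<^sup>2"
      by (simp add: power_mult_distrib mult_ac)
    show "0 \<le> (1 + e\<^sup>2) * (q * K)" using q0 K by simp
  qed
  then have "sqrt M * (real r - 1) * p\<^sup>2 \<le> (1 + e\<^sup>2) * (q * K) * p\<^sup>2"
    by (rule mult_right_mono) simp
  ultimately have "q * K \<le> (1 + e\<^sup>2) * (q * K) * p\<^sup>2 + e * K"
    using WE WD WH by linarith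
  also have "\<dots> \<le> (1 + e\<^sup>2) * (q * K) * p\<^sup>2 + 2 * e * (q * K)"
    using q0 K e0 mult_right_mono[of "1/2" q "e * K"] by (simp add: mult_ac)
  finally have "(q * K) * 1 \<le> (q * K) * ((1 + e\<^sup>2) * p\<^sup>2 + 2 * e)" by (simp add: algebra_simps)
  then have "1 \<le> (1 + e\<^sup>2) * p\<^sup>2 + 2 * e"
    using q0 K by (simp add: mult_le_cancel_left)
  also have "\<dots> \<le> p\<^sup>2 + e\<^sup>2 + 2 * e"
    using p_le by (simp add: algebra_simps mult_left_le)
  also have "e\<^sup>2 \<le> e"
  proof -
    have "h\<^sup>2 \<le> 1" using h_pos h_le_1 by (simp add: power_le_one)
    then have "e \<le> 1" by (simp add: e_def)
    then show ?thesis using e0 by (simp add: power2_eq_square mult_left_le)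
  qed
  finally have "(\<Sum>u<n. (x u - p * z u)\<^sup>2) \<le> h\<^sup>2" unfolding dist by (simp add: e_def)
  moreover have "(\<Sum>u\<in>S. (x u - p * z u)\<^sup>2) \<le> (\<Sum>u<n. (x u - p * z u)\<^sup>2)"
    using S by (intro sum_mono2) auto
  ultimately have D: "(\<Sum>u\<in>S. (x u - p * z u)\<^sup>2) \<le> h\<^sup>2" by linarith

  \<comment> \<open>The weight \<open>h\<close> balances the two errors: a relative loss
    \<open>h\<close> on the main term, and \<open>(1 + 1 / h) * h\<^sup>2 = h + h\<^sup>2\<close>
    from the distance to \<open>p * z\<close>, together at most \<open>3 * h\<close>.\<close>
  have young: "(a + b)\<^sup>2 \<le> (1 + h) * a\<^sup>2 + (1 + 1 / h) * b\<^sup>2" for a b :: real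
  proof -
    have "(1 + h) * a\<^sup>2 + (1 + 1 / h) * b\<^sup>2 - (a + b)\<^sup>2 = (h * a - b)\<^sup>2 / h"
      using h_pos by (simp add: power2_eq_square field_simps)
    then show ?thesis using h_pos by (metis diff_ge_0_iff_ge divide_nonneg_pos zero_le_power2)
  qed
  have Z: "(\<Sum>u\<in>S. (z u)\<^sup>2) \<le> 1"
    using sum_mono2[OF _ S, of "\<lambda>u. (z u)\<^sup>2"] z1 by simp
  have "(\<Sum>u\<in>S. (x u)\<^sup>2) \<le> (\<Sum>u\<in>S. (1 + h) * p\<^sup>2 * (z u)\<^sup>2 + (1 + 1 / h) * (x u - p * z u)\<^sup>2)"
  proof (rule sum_mono)
    fix u show "(x u)\<^sup>2 \<le> (1 + h) * p\<^sup>2 * (z u)\<^sup>2 + (1 + 1 / h) * (x u - p * z u)\<^sup>2"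
      using young[of "p * z u" "x u - p * z u"] by (simp add: power_mult_distrib mult.assoc)
  qed
  also have "\<dots> = (1 + h) * (p\<^sup>2 * (\<Sum>u\<in>S. (z u)\<^sup>2)) + (1 + 1 / h) * (\<Sum>u\<in>S. (x u - p * z u)\<^sup>2)"
    by (simp add: sum.distrib sum_distrib_left mult.assoc)
  also have "\<dots> \<le> (1 + h) * (1 * (\<Sum>u\<in>S. (z u)\<^sup>2)) + (1 + 1 / h) * h\<^sup>2"
    using p_le D h_pos by (intro add_mono mult_left_mono mult_right_mono) (auto intro: sum_nonneg)
  also have "\<dots> \<le> (\<Sum>u\<in>S. (z u)\<^sup>2) + h + (h + h\<^sup>2)"
    using h_pos Z by (simp add: algebra_simps power2_eq_square mult_left_le)
  also have "h\<^sup>2 \<le> h" using h_pos h_le_1 by (simp add: power2_eq_square mult_left_le)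
  finally show ?thesis by (simp add: sum_z2[OF S])
qed

section \<open>Graphs of large spectral radius\<close>

text \<open>The spectral radius is at most \<open>W\<close>, Cauchy-Schwarz bounds
  \<open>W\<^sup>2\<close> by \<open>2 * card E * Y\<close>, and Motzkin-Straus bounds
  \<open>Y\<close> by \<open>1 - 1 / r\<close>. The hypothesis forces equality throughout, and the
  equality cases yield the structure.\<close>

lemma large_lambda_structure:
  assumes ge: "(1 - 1 / real r) * (2 * real (card E)) \<le> (graph_lambda n E)\<^sup>2"
  shows "(graph_lambda n E)\<^sup>2 = (1 - 1 / real r) * (2 * real (card E))"
    and "\<exists>Q. (\<forall>i<r. Q i \<noteq> {}) \<and> (\<forall>i<r. \<forall>j<r. i \<noteq> j \<longrightarrow> Q i \<inter> Q j = {}) \<and>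
      (3 \<le> r \<longrightarrow> (\<forall>i<r. \<forall>j<r. card (Q i) = card (Q j))) \<and> E = cmp_edges r Q"
proof -
  have "P 0 \<noteq> {}" using card_P_pos[of 0] r by auto
  then have n: "n > 0" using sub[of 0] r by auto
  obtain x where x0: "\<And>u. x u \<ge> 0" and x1: "(\<Sum>u<n. (x u)\<^sup>2) = 1"
    and lam: "graph_lambda n E \<le> (\<Sum>(u, v)\<in>opairs E. x u * x v)"
    using graph_lambda_le_quadratic_form[OF E n] by blast
  define W where "W = (\<Sum>(u, v)\<in>opairs E. x u * x v)"
  define Y where "Y = (\<Sum>(u, v)\<in>opairs E. (x u)\<^sup>2 * (x v)\<^sup>2)"
  define q where "q = 1 - 1 / real r"
  note m = card_E_pos
  have q: "q > 0" using r by (simp add: q_def)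
  have lamW: "(graph_lambda n E)\<^sup>2 \<le> W\<^sup>2"
    using lam graph_lambda_nonneg[OF n] by (simp add: W_def power_mono)
  have big: "(1 - 1 / real r) * (2 * real (card E)) \<le> (\<Sum>(u, v)\<in>opairs E. x u * x v)\<^sup>2"
    using ge lamW by (simp add: W_def)
  have Y': "Y = (\<Sum>p\<in>opairs E. (case p of (u, v) \<Rightarrow> x u * x v)\<^sup>2)"
    unfolding Y_def by (intro sum.cong) (auto simp: power_mult_distrib)
  have cardO: "real (card (opairs E)) = 2 * real (card E)"
    using card_opairs[OF E] by simp
  have CS: "W\<^sup>2 \<le> 2 * real (card E) * Y"
    using Cauchy_Schwarz_ineq_sum[of "\<lambda>_. 1" "\<lambda>(u, v). x u * x v" "opairs E"]
    by (simp add: W_def Y' card_opairs[OF E])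
  have "2 * real (card E) * q \<le> 2 * real (card E) * Y"
    using ge lamW CS unfolding q_def mult.commute[of "2 * real (card E)"] by linarith
  then have qY: "q \<le> Y" using m by simp
  note mass = mass_le_density[OF x0 x1 big]
  have h3: "3 * h \<le> 1 / (32 * real r)" using h_le r by (simp add: field_simps)
  have weak_sub: "weak \<subseteq> {..<n}" by (auto simp: weak_def)
  \<comment> \<open>The deficit 1/8 in density is worth \<open>1 / (8 * r)\<close> in mass;
    subtracting the error \<open>1 / (32 * r)\<close> leaves \<open>3 / (32 * r)\<close>.\<close>
  have weak_sum: "(\<Sum>v | {u, v} \<in> E. (x v)\<^sup>2) \<le> 1 - 1 / r - 3 / (32 * r)" if "u \<in> weak" for u
  proof -
    have "(\<Sum>v | {u, v} \<in> E. (x v)\<^sup>2) \<le> density {v. {u, v} \<in> E} / r + 3 * h"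
      using E by (intro mass) (auto dest: simple_graph_edgeD)
    also have "density {v. {u, v} \<in> E} / r \<le> (real r - 1 - 1 / 8) / r"
      using that r by (intro divide_right_mono) (auto simp: weak_def)
    also have "(real r - 1 - 1 / 8) / r = 1 - 1 / r - 1 / (8 * r)"
      using r by (simp add: field_simps)
    finally have "(\<Sum>v | {u, v} \<in> E. (x v)\<^sup>2) \<le> 1 - 1 / r - 1 / (8 * r) + 1 / (32 * r)"
      using h3 by simp
    also have "\<dots> = 1 - 1 / r - 3 / (32 * r)" using r by (simp add: field_simps)
    finally show ?thesis .
  qed
  have light: "(\<Sum>u\<in>weak. (x u)\<^sup>2) < 2 * (3 / (32 * r))"
  proof -
    have "density weak / r \<le> (1 / 64) / r"
      using density_weak by (intro divide_right_mono) auto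
    then have "(\<Sum>u\<in>weak. (x u)\<^sup>2) \<le> (1 / 64) / r + 1 / (32 * r)"
      using mass[OF weak_sub] h3 by linarith
    also have "\<dots> < 2 * (3 / (32 * r))" using r by (simp add: field_simps)
    finally show ?thesis .
  qed
  have qY': "1 - 1 / real r \<le> (\<Sum>(u, v)\<in>opairs E. (x u)\<^sup>2 * (x v)\<^sup>2)"
    using qY by (simp add: q_def Y_def)
  have "(x u)\<^sup>2 \<ge> 0" for u by simp
  note ms = motzkin_straus_weak[of n E r "\<lambda>u. (x u)\<^sup>2" weak cls "3 / (32 * r)",
      OF E r this x1 weak_sub cls(1) strong_proper weak_sum light qY']
  have Yq: "Y = q" using ms(1) by (simp add: Y_def q_def)
  have Weq: "W\<^sup>2 = 2 * real (card E) * q"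
    using CS lamW ge unfolding Yq q_def mult.commute[of "2 * real (card E)"] by linarith
  show "(graph_lambda n E)\<^sup>2 = (1 - 1 / real r) * (2 * real (card E))"
    using Weq lamW ge unfolding q_def mult.commute[of "2 * real (card E)"] by linarith
  \<comment> \<open>\<open>c\<close> is the mean of \<open>x u * x v\<close> over the ordered edges.
    Equality in Cauchy-Schwarz makes the variance zero, so every edge attains the mean.\<close>
  define c where "c = W / (2 * real (card E))"
  have "W \<ge> 0" unfolding W_def by (intro sum_nonneg) (auto simp: x0)
  moreover have "W \<noteq> 0" using Weq m q by auto
  ultimately have c: "c > 0" using m by (simp add: c_def)
  have const: "x u * x v = c" if "{u, v} \<in> E" for u v
  proof -
    let ?w = "\<lambda>(u, v). x u * x v"
    have "(\<Sum>p\<in>opairs E. (?w p - c)\<^sup>2) = (\<Sum>p\<in>opairs E. (?w p)\<^sup>2 - 2 * c * ?w p + c\<^sup>2)"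
      by (intro sum.cong) (auto simp: power2_eq_square algebra_simps)
    also have "\<dots> = Y - 2 * c * W + 2 * real (card E) * c\<^sup>2"
      by (simp add: sum.distrib sum_subtractf Y' W_def sum_distrib_left cardO)
    also have "\<dots> = Y - W\<^sup>2 / (2 * real (card E))"
      using m by (simp add: c_def power2_eq_square field_simps)
    also have "\<dots> = 0" using m by (simp add: Weq Yq)
    finally have "\<forall>p\<in>opairs E. (?w p - c)\<^sup>2 = 0"
      using finite_opairs[OF E] by (subst (asm) sum_nonneg_eq_0_iff) auto
    moreover have "(u, v) \<in> opairs E" using that by simp
    ultimately have "(?w (u, v) - c)\<^sup>2 = 0" by (rule bspec)
    then show ?thesis by simp
  qed
  \<comment> \<open>Only vertices of positive weight are kept. As \<open>c > 0\<close>, all others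
    are isolated.\<close>
  define Q where "Q i = {u. u < n \<and> u \<notin> weak \<and> cls u = i \<and> x u > 0}" for i
  have sumQ: "(\<Sum>u\<in>Q i. (x u)\<^sup>2) = 1 / r" if "i < r" for i
  proof -
    have "(\<Sum>u\<in>Q i. (x u)\<^sup>2) = (\<Sum>u | u < n \<and> u \<notin> weak \<and> cls u = i. (x u)\<^sup>2)"
    proof (rule sum.mono_neutral_left)
      show "\<forall>u\<in>{u. u < n \<and> u \<notin> weak \<and> cls u = i} - Q i. (x u)\<^sup>2 = 0"
      proof
        fix u assume "u \<in> {u. u < n \<and> u \<notin> weak \<and> cls u = i} - Q i"
        then have "\<not> x u > 0" by (auto simp: Q_def)
        then show "(x u)\<^sup>2 = 0" using x0[of u] by simp
      qed
    qed (auto simp: Q_def)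
    then show ?thesis using ms(3)[of i] that by simp
  qed
  have Qne: "Q i \<noteq> {}" if "i < r" for i
    using sumQ[OF that] r by auto
  have Q_edge: "{u, v} \<in> E" if "u \<in> Q i" "v \<in> Q j" "i \<noteq> j" for u v i j
    using ms(4)[of u v] that by (auto simp: Q_def)
  have E_Q: "E = cmp_edges r Q"
  proof
    show "cmp_edges r Q \<subseteq> E" using Q_edge by (auto simp: cmp_edges_def)
    show "E \<subseteq> cmp_edges r Q"
    proof
      fix e assume e: "e \<in> E"
      then obtain u v where uv: "e = {u, v}" using E by (auto simp: simple_graph_def card_2_iff)
      have euv: "{u, v} \<in> E" using e uv by simp
      have "x u \<noteq> 0" "x v \<noteq> 0" using const[OF euv] c by auto
      then have pos: "x u > 0" "x v > 0" using x0[of u] x0[of v] by auto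
      then have nw: "u \<notin> weak" "v \<notin> weak" using ms(2) by force+
      note simple_graph_edgeD[OF E euv]
      then have "u \<in> Q (cls u)" "v \<in> Q (cls v)" using pos nw by (auto simp: Q_def)
      then show "e \<in> cmp_edges r Q"
        using strong_proper[OF euv nw] cls(1) uv unfolding cmp_edges_def by blast
    qed
  qed
  have "card (Q i) = 1 / (r * c)" if r3: "3 \<le> r" and i: "i < r" for i
  proof -
    \<comment> \<open>With two further classes, \<open>u\<close> lies in a triangle whose three
      products all equal \<open>c\<close>; hence its three entries agree. For \<open>r = 2\<close>
      there is no triangle, and the class sizes may differ.\<close>
    define j k :: nat where "j = (if i = 0 then 1 else 0)" and "k = (if i = 2 then 1 else 2)"
    then have jk: "j < r" "k < r" "j \<noteq> i" "k \<noteq> i" "j \<noteq> k" using r3 by auto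
    obtain v w where vw: "v \<in> Q j" "w \<in> Q k" using Qne jk by blast
    have "(x u)\<^sup>2 = c" if u: "u \<in> Q i" for u
    proof -
      have e: "x u * x v = c" "x u * x w = c" "x v * x w = c"
        using const Q_edge u vw jk by metis+
      have pos: "x u > 0" "x v > 0" "x w > 0" using u vw by (auto simp: Q_def)
      have "x v = x w" using e(1,2) pos by (metis less_irrefl mult_left_cancel)
      then have "x v = x u" using e(1,3) pos by (metis less_irrefl mult_right_cancel)
      then show ?thesis using e(1) by (simp add: power2_eq_square)
    qed
    then have "real (card (Q i)) * c = 1 / r" using sumQ[OF i] by simp
    then show ?thesis using c r by (simp add: field_simps)
  qed
  then have "card (Q i) = card (Q j)" if "3 \<le> r" "i < r" "j < r" for i j
    using that by (metis of_nat_eq_iff)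
  moreover have "Q i \<inter> Q j = {}" if "i \<noteq> j" for i j using that by (auto simp: Q_def)
  ultimately show "\<exists>Q. (\<forall>i<r. Q i \<noteq> {}) \<and> (\<forall>i<r. \<forall>j<r. i \<noteq> j \<longrightarrow> Q i \<inter> Q j = {}) \<and>
      (3 \<le> r \<longrightarrow> (\<forall>i<r. \<forall>j<r. card (Q i) = card (Q j))) \<and> E = cmp_edges r Q"
    using Qne E_Q by (intro exI[of _ Q] conjI allI impI)
qed

end

section \<open>Spectral radius of complete multipartite graphs\<close>

text \<open>The vector with entries \<open>1 / sqrt (card (Q i))\<close> on \<open>Q i\<close> has
  eigenvalue \<open>(r - 1) * sqrt M\<close>: over \<open>Q j\<close> it sums to
  \<open>sqrt (card (Q j))\<close>, which is \<open>sqrt M\<close> times its entry on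
  \<open>Q i\<close>.\<close>

lemma complete_multipartite_lambda_ge:
  assumes E: "simple_graph n (cmp_edges r Q)" and r: "2 \<le> r"
    and ne: "\<And>i. i < r \<Longrightarrow> Q i \<noteq> {}"
    and disj: "\<And>i j. i < r \<Longrightarrow> j < r \<Longrightarrow> i \<noteq> j \<Longrightarrow> Q i \<inter> Q j = {}"
    and prod: "\<And>i j. i < r \<Longrightarrow> j < r \<Longrightarrow> i \<noteq> j \<Longrightarrow> card (Q i) * card (Q j) = M"
  shows "(1 - 1 / real r) * (2 * real (card (cmp_edges r Q))) \<le> (graph_lambda n (cmp_edges r Q))\<^sup>2"
proof -
  \<comment> \<open>As there are at least two nonempty parts, every vertex of a part is the end of
    an edge and so lies below \<open>n\<close>.\<close>
  have sub: "Q i \<subseteq> {0..<n}" if i: "i < r" for i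
  proof
    fix u assume u: "u \<in> Q i"
    define j :: nat where "j = (if i = 0 then 1 else 0)"
    then have j: "j < r" "j \<noteq> i" using r by auto
    obtain v where "v \<in> Q j" using ne[OF j(1)] by blast
    then have "{u, v} \<in> cmp_edges r Q" using cmp_edges_iff[of r Q i u v, OF disj i u] j by blast
    then show "u \<in> {0..<n}" using simple_graph_edgeD(1)[OF E] by simp
  qed
  have fin: "finite (Q i)" if "i < r" for i
    by (rule finite_subset[OF sub[OF that]]) simp
  have pos: "card (Q i) > 0" if "i < r" for i using ne[OF that] fin[OF that] by (simp add: card_gt_0_iff)
  define z where "z u = (\<Sum>i<r. if u \<in> Q i then 1 / sqrt (card (Q i)) else 0)" for u
  have zQ: "z u = 1 / sqrt (card (Q i))" if "i < r" "u \<in> Q i" for u i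
  proof -
    have only: "u \<in> Q j \<longleftrightarrow> j = i" if "j < r" for j using disj[OF that \<open>i < r\<close>] \<open>u \<in> Q i\<close> by auto
    have "z u = (\<Sum>j<r. if j = i then 1 / sqrt (card (Q i)) else 0)"
      unfolding z_def by (intro sum.cong) (auto simp: only)
    then show ?thesis using that by simp
  qed
  define \<mu> where "\<mu> = (real r - 1) * sqrt M"
  have "\<bar>\<mu>\<bar> \<le> graph_lambda n (cmp_edges r Q)"
  proof -
    obtain w where w: "w \<in> Q 0" using ne[of 0] r by auto
    show ?thesis
    proof (rule graph_lambda_ge_eigenvalue[OF E, of w z])
      show "w < n" using sub[of 0] w r by auto
      show "z w \<noteq> 0" using zQ[of 0 w] w pos[of 0] r by simp
      fix u assume "u < n"
      show "(\<Sum>v | {u, v} \<in> cmp_edges r Q. z v) = \<mu> * z u"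
      proof (cases "\<exists>i<r. u \<in> Q i")
        case True
        then obtain i where i: "i < r" "u \<in> Q i" by blast
        have "{v. {u, v} \<in> cmp_edges r Q} = (\<Union>j\<in>{..<r} - {i}. Q j)"
          using cmp_edges_iff[of r Q i u, OF disj i] by auto
        then have "(\<Sum>v | {u, v} \<in> cmp_edges r Q. z v) = (\<Sum>j\<in>{..<r} - {i}. \<Sum>v\<in>Q j. z v)"
          using fin disj by (simp only:) (subst sum.UNION_disjoint, auto)
        also have "\<dots> = (\<Sum>j\<in>{..<r} - {i}. sqrt M * z u)"
        proof (intro sum.cong refl)
          fix j assume j: "j \<in> {..<r} - {i}"
          have "(\<Sum>v\<in>Q j. z v) = (\<Sum>v\<in>Q j. 1 / sqrt (card (Q j)))"
            using j by (intro sum.cong) (auto simp: zQ)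
          also have "\<dots> = sqrt (card (Q j))" by (simp add: real_div_sqrt)
          also have "\<dots> = sqrt M * z u"
            using prod[of i j] i j pos[OF i(1)] by (auto simp: zQ real_sqrt_mult)
          finally show "(\<Sum>v\<in>Q j. z v) = sqrt M * z u" .
        qed
        also have "\<dots> = \<mu> * z u" using i r by (simp add: \<mu>_def of_nat_diff)
        finally show ?thesis .
      next
        case False
        then have "{v. {u, v} \<in> cmp_edges r Q} = {}" "z u = 0"
          by (auto simp: cmp_edges_def doubleton_eq_iff z_def)
        then show ?thesis by simp
      qed
    qed
  qed
  then have "\<mu>\<^sup>2 \<le> (graph_lambda n (cmp_edges r Q))\<^sup>2" by (metis abs_ge_zero power2_abs power_mono)
  moreover have "(1 - 1 / real r) * (2 * real (card (cmp_edges r Q))) = \<mu>\<^sup>2"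
  proof -
    have "real (2 * card (cmp_edges r Q)) = real (r * (r - 1) * M)"
      using card_cmp_edges[of r Q n, OF sub disj prod] by simp
    then have cE: "2 * real (card (cmp_edges r Q)) = real r * (real r - 1) * M"
      using r by (simp add: of_nat_diff)
    show ?thesis
      unfolding cE using r by (simp add: \<mu>_def power_mult_distrib power2_eq_square field_simps)
  qed
  ultimately show ?thesis by simp
qed

section \<open>Choice of constants and the equality case\<close>

theorem theorem3p1:
  shows "\<forall>t r :: nat. 0 < t \<and> 2 \<le> r \<longrightarrow>
    (\<exists>\<epsilon>::real. \<epsilon> > 0 \<and> (\<exists>n0::nat.
      \<forall>(n::nat) (E::nat set set) (P::nat \<Rightarrow> nat set).
        simple_graph n E \<and>
        free (Krplus_edges r t) E \<and>
        (\<forall>i<r. P i \<subseteq> {0..<n} \<and> P i \<noteq> {} \<and> n0 \<le> card (P i)) \<and>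
        (\<forall>i<r. \<forall>j<r. i \<noteq> j \<longrightarrow> P i \<inter> P j = {}) \<and>
        (3 \<le> r \<longrightarrow> (\<forall>i<r. \<forall>j<r. card (P i) = card (P j))) \<and>
        real (card ((E - cmp_edges r P) \<union> (cmp_edges r P - E))) \<le> \<epsilon> * real (card E)
      \<longrightarrow>
        (graph_lambda n E)\<^sup>2 \<le> (1 - 1 / real r) * (2 * real (card E)) \<and>
        ((graph_lambda n E)\<^sup>2 = (1 - 1 / real r) * (2 * real (card E)) \<longleftrightarrow>
          ((r = 2 \<and> is_complete_multipartite 2 E) \<or>
           (3 \<le> r \<and> is_regular_complete_multipartite r E)))))"
proof (intro allI impI, elim conjE)
  fix t r :: nat assume r: "2 \<le> r"
  define s where "s = t + 2"
  define h where "h = 1 / (96 * (real r)\<^sup>2 * real s)"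
  have "h > 0" using r by (simp add: h_def s_def)
  \<comment> \<open>For \<open>r = 2\<close> the only pairs of distinct indices are (0, 1) and (1,
    0), so unequal part sizes do no harm.\<close>
  have prod_const: "card (P i) * card (P j) = card (P 0) * card (P 1)"
    if "3 \<le> r \<longrightarrow> (\<forall>i<r. \<forall>j<r. card (P i) = card (P j))" "i < r" "j < r" "i \<noteq> j"
    for P :: "nat \<Rightarrow> nat set" and i j
  proof (cases "3 \<le> r")
    case True
    then have eq: "card (P k) = card (P l)" if "k < r" "l < r" for k l
      using \<open>3 \<le> r \<longrightarrow> _\<close> that by blast
    show ?thesis using eq[of i 0] eq[of j 1] that r by simp
  next
    case False
    then have "i = 0 \<and> j = 1 \<or> i = 1 \<and> j = 0" using that r by auto
    then show ?thesis by auto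
  qed
  have near: "near_multipartite n r t s (card (P 0) * card (P 1)) E P h"
    if hyp: "simple_graph n E \<and>
        free (Krplus_edges r t) E \<and>
        (\<forall>i<r. P i \<subseteq> {0..<n} \<and> P i \<noteq> {} \<and> 32 * s \<le> card (P i)) \<and>
        (\<forall>i<r. \<forall>j<r. i \<noteq> j \<longrightarrow> P i \<inter> P j = {}) \<and>
        (3 \<le> r \<longrightarrow> (\<forall>i<r. \<forall>j<r. card (P i) = card (P j))) \<and>
        real (card ((E - cmp_edges r P) \<union> (cmp_edges r P - E))) \<le> h ^ 4 / 9 * real (card E)" for n E P
  proof (rule near_multipartite.intro)
    show "card (P i) * card (P j) = card (P 0) * card (P 1)" if "i < r" "j < r" "i \<noteq> j" for i j
      using hyp that by (intro prod_const) blast+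
    show "2 \<le> r" "s = t + 2" "h = 1 / (96 * (real r)\<^sup>2 * real s)"
      using r by (simp_all add: s_def h_def)
  qed (use hyp in blast)+
  show "\<exists>\<epsilon>::real. \<epsilon> > 0 \<and> (\<exists>n0::nat.
      \<forall>(n::nat) (E::nat set set) (P::nat \<Rightarrow> nat set).
        simple_graph n E \<and>
        free (Krplus_edges r t) E \<and>
        (\<forall>i<r. P i \<subseteq> {0..<n} \<and> P i \<noteq> {} \<and> n0 \<le> card (P i)) \<and>
        (\<forall>i<r. \<forall>j<r. i \<noteq> j \<longrightarrow> P i \<inter> P j = {}) \<and>
        (3 \<le> r \<longrightarrow> (\<forall>i<r. \<forall>j<r. card (P i) = card (P j))) \<and>
        real (card ((E - cmp_edges r P) \<union> (cmp_edges r P - E))) \<le> \<epsilon> * real (card E)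
      \<longrightarrow>
        (graph_lambda n E)\<^sup>2 \<le> (1 - 1 / real r) * (2 * real (card E)) \<and>
        ((graph_lambda n E)\<^sup>2 = (1 - 1 / real r) * (2 * real (card E)) \<longleftrightarrow>
          ((r = 2 \<and> is_complete_multipartite 2 E) \<or>
           (3 \<le> r \<and> is_regular_complete_multipartite r E))))"
  proof (intro exI[of _ "h ^ 4 / 9"] conjI exI[of _ "32 * s"] allI impI, goal_cases)
    case 1
    then show ?case using \<open>h > 0\<close> by simp
  next
    case (2 n E P)
    from near[OF this] interpret near_multipartite n r t s "card (P 0) * card (P 1)" E P h .
    \<comment> \<open>A violation of the bound would satisfy the hypothesis of
      \<open>large_lambda_structure\<close>, which then gives equality.\<close>
    show ?case
    proof (rule ccontr)
      assume *: "\<not> ?case"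
      then have "(1 - 1 / real r) * (2 * real (card E)) \<le> (graph_lambda n E)\<^sup>2" by linarith
      then show False using large_lambda_structure(1) * by simp
    qed
  next
    case (3 n E P)
    from near[OF this] interpret near_multipartite n r t s "card (P 0) * card (P 1)" E P h .
    let ?b = "(1 - 1 / real r) * (2 * real (card E))"
    show ?case
    proof
      assume "(graph_lambda n E)\<^sup>2 = ?b"
      then have "?b \<le> (graph_lambda n E)\<^sup>2" by simp
      then obtain Q where Q: "\<forall>i<r. Q i \<noteq> {}" "\<forall>i<r. \<forall>j<r. i \<noteq> j \<longrightarrow> Q i \<inter> Q j = {}"
        "3 \<le> r \<longrightarrow> (\<forall>i<r. \<forall>j<r. card (Q i) = card (Q j))" "E = cmp_edges r Q"
        using large_lambda_structure(2) by blast
      show "(r = 2 \<and> is_complete_multipartite 2 E) \<or> (3 \<le> r \<and> is_regular_complete_multipartite r E)"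
      proof (cases "r = 2")
        case True
        then have "is_complete_multipartite 2 E"
          unfolding is_complete_multipartite_def using Q(1,2,4) by (intro exI[of _ Q] conjI) simp_all
        then show ?thesis using True by simp
      next
        case False
        then have "3 \<le> r" using r by simp
        moreover from this have "is_regular_complete_multipartite r E"
          unfolding is_regular_complete_multipartite_def
          by (intro exI[of _ Q] conjI Q(1,2,4) mp[OF Q(3)])
        ultimately show ?thesis by simp
      qed
    next
      assume asm: "(r = 2 \<and> is_complete_multipartite 2 E) \<or> (3 \<le> r \<and> is_regular_complete_multipartite r E)"
      have "\<exists>Q. (\<forall>i<r. Q i \<noteq> {}) \<and> (\<forall>i<r. \<forall>j<r. i \<noteq> j \<longrightarrow> Q i \<inter> Q j = {}) \<and>
        (3 \<le> r \<longrightarrow> (\<forall>i<r. \<forall>j<r. card (Q i) = card (Q j))) \<and> E = cmp_edges r Q"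
      proof (cases "r = 2")
        case True
        then have "is_complete_multipartite 2 E" using asm by simp
        then obtain Q where "\<forall>i<2. Q i \<noteq> {}" "\<forall>i<2. \<forall>j<2. i \<noteq> j \<longrightarrow> Q i \<inter> Q j = {}" "E = cmp_edges 2 Q"
          unfolding is_complete_multipartite_def by (elim exE conjE)
        then show ?thesis using True by (intro exI[of _ Q] conjI) simp_all
      next
        case False
        then have "is_regular_complete_multipartite r E" using asm by simp
        then obtain Q where "\<forall>i<r. Q i \<noteq> {}" "\<forall>i<r. \<forall>j<r. i \<noteq> j \<longrightarrow> Q i \<inter> Q j = {}"
          "\<forall>i<r. \<forall>j<r. card (Q i) = card (Q j)" "E = cmp_edges r Q"
          unfolding is_regular_complete_multipartite_def by (elim exE conjE)
        then show ?thesis by (intro exI[of _ Q] conjI impI)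
      qed
      then obtain Q where Q: "\<forall>i<r. Q i \<noteq> {}" "\<forall>i<r. \<forall>j<r. i \<noteq> j \<longrightarrow> Q i \<inter> Q j = {}"
        "3 \<le> r \<longrightarrow> (\<forall>i<r. \<forall>j<r. card (Q i) = card (Q j))" and EQ: "E = cmp_edges r Q"
        by (elim exE conjE)
      \<comment> \<open>The lower bound suffices, since \<open>large_lambda_structure\<close> turns
        it into equality.\<close>
      have "?b \<le> (graph_lambda n E)\<^sup>2"
        unfolding EQ
      proof (rule complete_multipartite_lambda_ge[OF E[unfolded EQ] r])
        show "card (Q i) * card (Q j) = card (Q 0) * card (Q 1)" if "i < r" "j < r" "i \<noteq> j" for i j
          using Q(3) that by (rule prod_const)
      qed (use Q(1,2) in blast)+
      then show "(graph_lambda n E)\<^sup>2 = ?b"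
        by (rule large_lambda_structure(1))
    qed
  qed
qed

end
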